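(* Let $G$ be a finite connected graph with root $r$, let $\mathcal{P}=\{F_1,\dots,F_t\}$ be a partition of $E(G)$ into $t$ classes, let $A\in\mathbb{F}_2^{c\times t}$ be its cycle–class parity matrix with respect to a cycle basis $B_1,\dots,B_c$ of $G$, and let $\rho=\mathrm{rank}_{\mathbb{F}_2}(A)$. Then: (i) the most generic consistent assignment has dimension $k=t-\rho$, given by $g_j=\pi(e_j)$, the images of the standard basis $e_1,\dots,e_t$ of $\mathbb{Z}_2^t$ under the quotient map $\pi\colon\mathbb{Z}_2^t\to\mathbb{Z}_2^t/\mathrm{rowspan}(A)\cong\mathbb{Z}_2^k$; every other consistent assignment is a linear image of it; (ii) the labeling $\lambda(v)=\sum_{e\in P(r,v)}g_{\mathrm{class}(e)}$ under this assignment is conflict-free, i.e. independent of the choice of the path $P(r,v)$ from $r$ to $v$; (iii) with $S=\{g_j : g_j\neq 0\}$, every path of length $\ell$ in $G$ maps under $\lambda$ to a walk of length $\ell$ in $\mathrm{Cay}(\mathbb{Z}_2^k,S)$, so $d_{\mathrm{Cay}}(\lambda(u),\lambda(v))\le d_G(u,v)$ for all $u,v\in V(G)$: the only possible failure of isometry is a shortcut (a pair with $d_{\mathrm{Cay}}<d_G$), never a stretch (a pair with $d_{\mathrm{Cay}}>d_G$).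
   Context: $c=|E(G)|-|V(G)|+1$ is the cycle rank. A cycle basis is a set of $c$ cycles whose edge sets form a basis over $\mathbb{F}_2$ of the cycle space of $G$. The cycle–class parity matrix is $A[i,j]=|F_j\cap E(B_i)|\bmod 2$. $\mathrm{class}(e)=j$ is the index with $e\in F_j$. An assignment of elements $g_1,\dots,g_t\in\mathbb{Z}_2^{k'}$ (for some $k'$) to the classes is consistent if $\sum_i g_{\mathrm{class}(e_i)}=0$ for every cycle $(e_1,\dots,e_\ell)$ of $G$ (equivalently for every cycle of a cycle basis, i.e. $A(g_1\mid\cdots\mid g_t)^{\top}=0$ over $\mathbb{F}_2$). A consistent assignment $(g'_j)$ in $\mathbb{Z}_2^{k'}$ is a linear image of $(g_j)$ if there is a linear map $T\colon\mathbb{Z}_2^k\to\mathbb{Z}_2^{k'}$ with $g'_j=T(g_j)$ for all $j$. $\mathrm{Cay}(\Gamma,S)$, for an abelian group $\Gamma$ and a generating set $S=-S\subseteq\Gamma\setminus\{0\}$, is the graph on $\Gamma$ with edges $\{h,h+s\}$, $h\in\Gamma$, $s\in S$; $d_{\mathrm{Cay}}$ is its graph metric and $d_G$ is the shortest-path metric of $G$.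
   Formalization: In (iii), edges whose class has g_j = 0 join equally labelled vertices, so a path maps to a walk of length ℓ that may stay put at exactly those steps; it is a genuine walk in Cay when no class element on the path is 0. The distance bound is unchanged. *)

theory Defs
  imports
    "Jordan_Normal_Form.DL_Rank"
    "HOL-Algebra.Algebra"
    "HOL-Library.Z2"
    "HOL-Library.Function_Algebras"
    "HOL-Library.Indicator_Function"
    "HOL-Library.Disjoint_Sets"
    "HOL-Library.Extended_Nat"
begin

section \<open>Graphs, paths and cycles\<close>

record 'v ugraph =
  verts :: "'v set"
  edges :: "'v set set"

definition simple_graph :: "'v ugraph \<Rightarrow> bool" where
  "simple_graph G \<longleftrightarrow> (\<forall>e\<in>edges G. e \<subseteq> verts G \<and> card e = 2)"

text \<open>Walks are lists of vertices; the length of a walk \<open>p\<close> is \<open>length p - 1\<close>.\<close>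

definition walk :: "'v ugraph \<Rightarrow> 'v list \<Rightarrow> bool" where
  "walk G p \<longleftrightarrow> p \<noteq> [] \<and> set p \<subseteq> verts G \<and> successively (\<lambda>u v. {u, v} \<in> edges G) p"

text \<open>A lazy walk may also stay at a vertex in any step. This is needed because a class can be
  assigned the zero element, in which case an edge of that class has two equal end labels.\<close>

definition lazy_walk :: "'v ugraph \<Rightarrow> 'v list \<Rightarrow> bool" where
  "lazy_walk G p \<longleftrightarrow>
     p \<noteq> [] \<and> set p \<subseteq> verts G \<and> successively (\<lambda>u v. u = v \<or> {u, v} \<in> edges G) p"

definition path :: "'v ugraph \<Rightarrow> 'v list \<Rightarrow> bool" where
  "path G p \<longleftrightarrow> walk G p \<and> distinct p"

definition path_between :: "'v ugraph \<Rightarrow> 'v \<Rightarrow> 'v \<Rightarrow> 'v list \<Rightarrow> bool" where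
  "path_between G u v p \<longleftrightarrow> path G p \<and> hd p = u \<and> last p = v"

definition connected_graph :: "'v ugraph \<Rightarrow> bool" where
  "connected_graph G \<longleftrightarrow>
     verts G \<noteq> {} \<and> (\<forall>u\<in>verts G. \<forall>v\<in>verts G. \<exists>p. path_between G u v p)"

text \<open>The value is \<open>\<infinity>\<close> if no path exists.\<close>

definition graph_dist :: "'v ugraph \<Rightarrow> 'v \<Rightarrow> 'v \<Rightarrow> enat" where
  "graph_dist G u v = (INF p\<in>{p. path_between G u v p}. enat (length p - 1))"

definition walk_edges :: "'v list \<Rightarrow> 'v set set" where
  "walk_edges p = (\<lambda>(u, v). {u, v}) ` set (zip p (tl p))"

text \<open>A cycle \<open>[v\<^sub>0, v\<^sub>1, \<dots>, v\<^sub>l]\<close> is a closed walk with \<open>v\<^sub>l = v\<^sub>0\<close>, \<open>l \<ge> 3\<close> and no other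
  repetition. Its edges are pairwise distinct, so sums along it are sums over \<^const>\<open>walk_edges\<close>;
  the same holds for paths.\<close>

definition cycle :: "'v ugraph \<Rightarrow> 'v list \<Rightarrow> bool" where
  "cycle G p \<longleftrightarrow> walk G p \<and> length p \<ge> 4 \<and> hd p = last p \<and> distinct (tl p)"


section \<open>Cycle space and cycle bases\<close>

text \<open>Edge sets are identified with their indicator functions, which live in the vector space
  of functions into the two-element field \<^typ>\<open>bit\<close>.\<close>

global_interpretation edge_space: vector_space "\<lambda>(a::bit) (f::'e \<Rightarrow> bit). (\<lambda>e. a * f e)"
  by unfold_locales (auto simp: fun_eq_iff algebra_simps)

definition cycle_space :: "'v ugraph \<Rightarrow> ('v set \<Rightarrow> bit) set" where
  "cycle_space G = edge_space.span {indicator (walk_edges p) |p. cycle G p}"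

text \<open>For connected graphs the subtraction does not truncate.\<close>

definition cycle_rank :: "'v ugraph \<Rightarrow> nat" where
  "cycle_rank G = card (edges G) + 1 - card (verts G)"

text \<open>Indices start at \<open>0\<close> throughout, as they do for matrices and vectors.\<close>

definition cycle_basis :: "'v ugraph \<Rightarrow> (nat \<Rightarrow> 'v list) \<Rightarrow> bool" where
  "cycle_basis G B \<longleftrightarrow>
     (\<forall>i<cycle_rank G. cycle G (B i)) \<and>
     inj_on (\<lambda>i. walk_edges (B i)) {..<cycle_rank G} \<and>
     (let b = (\<lambda>i. indicator (walk_edges (B i))) ` {..<cycle_rank G} in
        edge_space.independent b \<and> edge_space.span b = cycle_space G)"


section \<open>Consistent assignments\<close>

definition edge_class :: "(nat \<Rightarrow> 'v set set) \<Rightarrow> nat \<Rightarrow> 'v set \<Rightarrow> nat" where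
  "edge_class F t e = (THE j. j < t \<and> e \<in> F j)"

text \<open>The coercion \<open>of_nat :: nat \<Rightarrow> bit\<close> is reduction modulo 2.\<close>

definition parity_matrix ::
    "'v ugraph \<Rightarrow> (nat \<Rightarrow> 'v set set) \<Rightarrow> nat \<Rightarrow> (nat \<Rightarrow> 'v list) \<Rightarrow> bit mat" where
  "parity_matrix G F t B =
     mat (cycle_rank G) t (\<lambda>(i, j). of_nat (card (F j \<inter> walk_edges (B i))))"

text \<open>The group \<open>\<int>\<^sub>2\<^sup>n\<close>, as a HOL-Algebra group. Group homomorphisms between elementary
  abelian 2-groups are the same as \<^typ>\<open>bit\<close>-linear maps, so quotients and isomorphisms can be
  taken in the category of groups.\<close>

abbreviation Z2 :: "nat \<Rightarrow> bit vec monoid" where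
  "Z2 n \<equiv> monoid_vec TYPE(bit) n"

definition class_sum ::
    "(nat \<Rightarrow> 'v set set) \<Rightarrow> nat \<Rightarrow> nat \<Rightarrow> (nat \<Rightarrow> bit vec) \<Rightarrow> 'v list \<Rightarrow> bit vec" where
  "class_sum F t k g p = finsum_vec TYPE(bit) k (\<lambda>e. g (edge_class F t e)) (walk_edges p)"

definition consistent ::
    "'v ugraph \<Rightarrow> (nat \<Rightarrow> 'v set set) \<Rightarrow> nat \<Rightarrow> nat \<Rightarrow> (nat \<Rightarrow> bit vec) \<Rightarrow> bool" where
  "consistent G F t k g \<longleftrightarrow>
     (\<forall>j<t. g j \<in> carrier_vec k) \<and> (\<forall>p. cycle G p \<longrightarrow> class_sum F t k g p = 0\<^sub>v k)"

definition linear_image ::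
    "nat \<Rightarrow> nat \<Rightarrow> (nat \<Rightarrow> bit vec) \<Rightarrow> nat \<Rightarrow> (nat \<Rightarrow> bit vec) \<Rightarrow> bool" where
  "linear_image t k g k' g' \<longleftrightarrow>
     (\<exists>T. linear_map class_ring (module_vec TYPE(bit) k) (module_vec TYPE(bit) k') T \<and>
        (\<forall>j<t. g' j = T (g j)))"

definition most_generic ::
    "'v ugraph \<Rightarrow> (nat \<Rightarrow> 'v set set) \<Rightarrow> nat \<Rightarrow> nat \<Rightarrow> (nat \<Rightarrow> bit vec) \<Rightarrow> bool" where
  "most_generic G F t k g \<longleftrightarrow>
     consistent G F t k g \<and> (\<forall>k' g'. consistent G F t k' g' \<longrightarrow> linear_image t k g k' g')"

text \<open>The dimension of the span of the assigned elements.\<close>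

definition assignment_dim :: "nat \<Rightarrow> nat \<Rightarrow> (nat \<Rightarrow> bit vec) \<Rightarrow> nat" where
  "assignment_dim t k g = vectorspace.dim class_ring
     (LinearCombinations.module.span_vs class_ring (module_vec TYPE(bit) k) (g ` {..<t}))"

text \<open>The label of a vertex is read off along an arbitrarily chosen path from the root.\<close>

definition labeling ::
    "'v ugraph \<Rightarrow> 'v \<Rightarrow> (nat \<Rightarrow> 'v set set) \<Rightarrow> nat \<Rightarrow> nat \<Rightarrow> (nat \<Rightarrow> bit vec) \<Rightarrow> 'v \<Rightarrow> bit vec" where
  "labeling G r F t k g v = class_sum F t k g (SOME p. path_between G r v p)"

definition conflict_free ::
    "'v ugraph \<Rightarrow> 'v \<Rightarrow> (nat \<Rightarrow> 'v set set) \<Rightarrow> nat \<Rightarrow> nat \<Rightarrow> (nat \<Rightarrow> bit vec) \<Rightarrow> bool" where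
  "conflict_free G r F t k g \<longleftrightarrow>
     (\<forall>v\<in>verts G. \<forall>p q. path_between G r v p \<and> path_between G r v q \<longrightarrow>
        class_sum F t k g p = class_sum F t k g q)"


section \<open>Cayley graphs\<close>

definition connection_set :: "('a, 'b) monoid_scheme \<Rightarrow> 'a set \<Rightarrow> bool" where
  "connection_set \<Gamma> S \<longleftrightarrow>
     S \<subseteq> carrier \<Gamma> - {\<one>\<^bsub>\<Gamma>\<^esub>} \<and> m_inv \<Gamma> ` S = S \<and> generate \<Gamma> S = carrier \<Gamma>"

definition cayley_graph :: "('a, 'b) monoid_scheme \<Rightarrow> 'a set \<Rightarrow> 'a ugraph" where
  "cayley_graph \<Gamma> S =
     \<lparr>verts = carrier \<Gamma>, edges = {{h, h \<otimes>\<^bsub>\<Gamma>\<^esub> s} |h s. h \<in> carrier \<Gamma> \<and> s \<in> S}\<rparr>"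

end

theory Submission
  imports Defs
begin

text \<open>Write \<open>M\<close> for the matrix with columns \<open>g\<^sub>0, \<dots>, g\<^sub>t\<^sub>-\<^sub>1\<close>. The sum of an assignment along a path or
  cycle is \<open>M\<close> applied to the vector of class parities of its edge set. This parity vector is linear
  in the edge set, so it lies in the row space \<open>R\<close> of \<open>A\<close> for every cycle, and \<open>g\<close> is consistent iff
  \<open>M\<close> kills \<open>R\<close>. Hence the consistent assignments are exactly the linear maps that factor through
  \<open>\<int>\<^sub>2\<^sup>t / R\<close>, which makes the quotient assignment the most generic one.

  Dimensions are computed by counting elements. Character sums give \<open>|W| |W\<^sup>\<bottom>| = 2\<^sup>n\<close> for every
  subgroup \<open>W\<close> of \<open>\<int>\<^sub>2\<^sup>n\<close>, and therefore \<open>W\<^sup>\<bottom>\<^sup>\<bottom> = W\<close>. As the kernel of \<open>A\<close> is \<open>R\<^sup>\<bottom>\<close> and its image is the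
  column space, \<open>|R| = 2\<^sup>\<rho>\<close>.

  A closed walk splits at a repeated vertex into two shorter ones, so sums vanish on all closed walks
  once they vanish on cycles; this gives well-defined labels, which change along an edge by the
  element of its class.\<close>

section \<open>Duality in \<open>\<int>\<^sub>2\<^sup>n\<close>\<close>

text \<open>These simp rules would turn sums and products of type \<^typ>\<open>bit\<close> into bit operations.\<close>

declare add_bit_eq_xor [simp del] mult_bit_eq_and [simp del]

section \<open>Counting vectors over the two-element field\<close>

lemma card_UNIV_bit: "card (UNIV :: bit set) = 2"
proof -
  have "(UNIV :: bit set) = {0, 1}" using bit.nchotomy by auto
  then show ?thesis by (metis card_2_iff zero_neq_one)
qed

text \<open>Every vector has exactly one coefficient function on a finite basis, and such functions
  are counted by a power of 2. This turns dimensions into cardinalities.\<close>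

lemma card_bit_vectorspace:
  fixes V (structure)
  assumes "vectorspace (class_ring :: bit ring) V" and "vectorspace.fin_dim class_ring V"
  shows "card (carrier V) = 2 ^ vectorspace.dim class_ring V"
proof -
  interpret vectorspace "class_ring :: bit ring" V by fact
  obtain \<beta> where \<beta>: "finite \<beta>" "basis \<beta>"
    using finite_basis_exists[OF assms(2)] by blast
  have sub: "\<beta> \<subseteq> carrier V" using \<beta>(2) unfolding basis_def by blast
  have U: "carrier (class_ring :: bit ring) = UNIV" by (simp add: class_ring_simps)
  have "bij_betw (\<lambda>a. lincomb a \<beta>) (\<beta> \<rightarrow>\<^sub>E UNIV) (carrier V)"
    unfolding bij_betw_def
  proof
    have uniq: "\<forall>v. v \<in> carrier V \<longrightarrow> (\<exists>!a. a \<in> \<beta> \<rightarrow>\<^sub>E UNIV \<and> lincomb a \<beta> = v)"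
      using basis_criterion[OF \<beta>(1) sub] \<beta>(2) unfolding U by blast
    have cl: "lincomb a \<beta> \<in> carrier V" for a
      by (rule lincomb_closed[OF sub]) (simp add: U)
    show "inj_on (\<lambda>a. lincomb a \<beta>) (\<beta> \<rightarrow>\<^sub>E UNIV)"
      proof (rule inj_onI)
      fix a b assume a: "a \<in> \<beta> \<rightarrow>\<^sub>E UNIV" and b: "b \<in> \<beta> \<rightarrow>\<^sub>E UNIV"
        and ab: "lincomb a \<beta> = lincomb b \<beta>"
      note the_eq = the1_equality[OF uniq[rule_format, OF cl[of a]]]
      show "a = b" using the_eq[of a] the_eq[of b] a b ab by simp
    qed
    show "(\<lambda>a. lincomb a \<beta>) ` (\<beta> \<rightarrow>\<^sub>E UNIV) = carrier V"
      proof (intro equalityI subsetI)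
      fix v assume "v \<in> carrier V"
      then show "v \<in> (\<lambda>a. lincomb a \<beta>) ` (\<beta> \<rightarrow>\<^sub>E UNIV)" using uniq by blast
    qed (use cl in blast)
  qed
  then have "card (carrier V) = card (\<beta> \<rightarrow>\<^sub>E (UNIV :: bit set))"
    by (metis bij_betw_same_card)
  also have "\<dots> = 2 ^ card \<beta>"
    using \<beta>(1) by (simp add: card_PiE card_UNIV_bit)
  finally show ?thesis using dim_basis[OF \<beta>] by simp
qed

lemma card_col_space_bit:
  fixes A :: "bit mat"
  assumes "A \<in> carrier_mat n m"
  shows "card (vec_space.col_space n A) = 2 ^ vec_space.rank n A"
proof -
  interpret vec_space "TYPE(bit)" n .
  have sub: "set (cols A) \<subseteq> carrier_vec n" using assms cols_dim by blast
  have "vectorspace class_ring (span_vs (set (cols A)))"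
    using sub span_is_subspace subspace_is_vs by simp
  from card_bit_vectorspace[OF this fin_dim_span[OF finite_set]] sub
  show ?thesis by (simp add: col_space_def rank_def)
qed

lemma card_carrier_bit_vec: "card (carrier_vec n :: bit vec set) = 2 ^ n"
proof -
  interpret vec_space "TYPE(bit)" n .
  show ?thesis using card_bit_vectorspace[OF vec_vs fin_dim] dim_is_n by (simp add: module_vec_simps)
qed

lemma finite_carrier_bit_vec: "finite (carrier_vec n :: bit vec set)"
  by (rule card_ge_0_finite) (simp add: card_carrier_bit_vec)

lemma add_self_bit_vec: "v \<in> carrier_vec n \<Longrightarrow> v + v = 0\<^sub>v n" for v :: "bit vec"
  by (intro eq_vecI) auto

lemma comm_group_Z2: "comm_group (Z2 n)" by (rule comm_group_vec)


text \<open>First isomorphism theorem combined with Lagrange; it plays the part of rank-nullity in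
  the counting arguments.\<close>

lemma (in group_hom) card_image_kernel:
  "card (h ` carrier G) * card (kernel G H h) = card (carrier G)"
proof -
  \<comment> \<open>Restricting the codomain to the image makes \<open>h\<close> surjective, as the
    isomorphism theorem requires.\<close>
  let ?H = "H\<lparr>carrier := h ` carrier G\<rparr>"
  interpret K: group_hom G ?H h
    by (intro group_hom.intro group_hom_axioms.intro G.is_group
        H.subgroup_imp_group img_is_subgroup) (auto simp: hom_def)
  have "(\<lambda>U. the_elem (h ` U)) \<in> iso (G Mod kernel G ?H h) ?H"
    by (rule K.FactGroup_iso_set) simp
  then have "card (carrier (G Mod kernel G ?H h)) = card (h ` carrier G)"
    by (auto simp: iso_def dest: bij_betw_same_card)
  moreover have "kernel G ?H h = kernel G H h" by (simp add: kernel_def)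
  ultimately show ?thesis
    using G.lagrange[OF subgroup_kernel] by (simp add: FactGroup_def Coset.order_def)
qed

section \<open>Character sums and orthogonal complements\<close>

text \<open>The nontrivial character of the two-element group. Its values are integers so that its
  sums can be compared with cardinalities.\<close>

definition bit_sign :: "bit \<Rightarrow> int" where
  "bit_sign b = (if b = 0 then 1 else - 1)"

text \<open>Translation by \<open>w0\<close> permutes \<open>W\<close> and flips every sign, so the
  sum equals its own negative.\<close>

lemma sum_bit_sign_eq_0:
  assumes W: "subgroup W (Z2 n)" and w0: "w0 \<in> W"
    and shift: "\<And>w. w \<in> W \<Longrightarrow> f (w + w0) = f w + 1"
  shows "(\<Sum>w\<in>W. bit_sign (f w)) = 0"
proof -
  interpret Z: comm_group "Z2 n" by (rule comm_group_Z2)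
  have WC: "W \<subseteq> carrier_vec n" using subgroup.subset[OF W] by (simp add: monoid_vec_simps)
  have cl: "w + w0 \<in> W" if "w \<in> W" for w
    using subgroup.m_closed[OF W that w0] by (simp add: monoid_vec_simps)
  have inv: "w + w0 + w0 = w" if "w \<in> W" for w
    proof -
    have "w \<in> carrier_vec n" "w0 \<in> carrier_vec n" using that w0 WC by auto
    then show ?thesis by (simp add: add_self_bit_vec[of w0 n])
  qed
  have "(\<Sum>w\<in>W. bit_sign (f w)) = (\<Sum>w\<in>W. bit_sign (f (w + w0)))"
    by (rule sum.reindex_bij_witness[of _ "\<lambda>w. w + w0" "\<lambda>w. w + w0"]) (auto simp: cl inv)
  also have "\<dots> = (\<Sum>w\<in>W. - bit_sign (f w))"
    by (rule sum.cong) (auto simp: shift bit_sign_def split: if_splits)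
  finally show ?thesis by (simp add: sum_negf)
qed

text \<open>The scalar product is not definite over \<open>bit\<close>, so \<open>W\<close> may meet
  its complement nontrivially; the duality below therefore rests on cardinalities.\<close>

abbreviation orth :: "nat \<Rightarrow> bit vec set \<Rightarrow> bit vec set" where
  "orth n W \<equiv> vec_module.orthogonal_complement n W"

lemma orth_def: "orth n W = {x \<in> carrier_vec n. \<forall>y\<in>W. x \<bullet> y = 0}"
  using vec_module.orthogonal_complement_def[of n W] by auto

lemma subgroup_orth:
  assumes "W \<subseteq> carrier_vec n"
  shows "subgroup (orth n W) (Z2 n)"
proof -
  interpret Z: comm_group "Z2 n" by (rule comm_group_Z2)
  show ?thesis
  proof (rule Z.subgroupI)
    show "orth n W \<noteq> {}" using assms by (auto simp: orth_def intro!: exI[of _ "0\<^sub>v n"])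
    show "inv\<^bsub>Z2 n\<^esub> a \<in> orth n W" if "a \<in> orth n W" for a
    proof -
      have "a \<in> carrier_vec n" using that by (simp add: orth_def)
      then have "inv\<^bsub>Z2 n\<^esub> a = a"
        by (intro Z.inv_equality) (auto simp: monoid_vec_simps add_self_bit_vec)
      with that show ?thesis by simp
    qed
    show "a \<otimes>\<^bsub>Z2 n\<^esub> b \<in> orth n W" if "a \<in> orth n W" "b \<in> orth n W" for a b
      using that assms by (auto simp: orth_def monoid_vec_simps add_scalar_prod_distrib[of _ n])
  qed (auto simp: orth_def monoid_vec_simps)
qed

text \<open>Double counting of the character sum \<open>\<Sum>\<^sub>w \<Sum>\<^sub>x (-1)\<^sup>x\<^sup>\<cdot>\<^sup>w\<close> over \<open>w \<in> W\<close> and all \<open>x\<close>.\<close>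

lemma card_orth:
  assumes W: "subgroup W (Z2 n)"
  shows "card W * card (orth n W) = 2 ^ n"
proof -
  let ?V = "carrier_vec n :: bit vec set"
  have WC: "W \<subseteq> ?V" using subgroup.subset[OF W] by (simp add: monoid_vec_simps)
  have fin: "finite ?V" "finite W" using finite_carrier_bit_vec finite_subset[OF WC] by auto
  have 0: "0\<^sub>v n \<in> W" using subgroup.one_closed[OF W] by (simp add: monoid_vec_simps)
  have V: "subgroup ?V (Z2 n)"
    using group.subgroup_self[OF comm_group.axioms(2)[OF comm_group_Z2]] by (simp add: monoid_vec_simps)
  \<comment> \<open>The character given by \<open>x\<close> is trivial on \<open>W\<close> exactly
    for \<open>x\<close> in the complement; otherwise some \<open>w0\<close> in \<open>W\<close>
    flips it.\<close>
  have inner1: "(\<Sum>w\<in>W. bit_sign (x \<bullet> w)) = (if x \<in> orth n W then int (card W) else 0)"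
    if x: "x \<in> ?V" for x
  proof (cases "x \<in> orth n W")
    case True
    then show ?thesis by (simp add: orth_def bit_sign_def)
  next
    case False
    with x obtain w0 where w0: "w0 \<in> W" "x \<bullet> w0 = 1" by (auto simp: orth_def)
    show ?thesis using False
      by (subst sum_bit_sign_eq_0[OF W w0(1)])
        (use WC w0 x in \<open>auto simp: scalar_prod_add_distrib[of _ n] subset_iff\<close>)
  qed
  \<comment> \<open>If \<open>w\<close> is nonzero at coordinate \<open>i\<close>, adding the unit
    vector at \<open>i\<close> to \<open>x\<close> flips the sign.\<close>
  have inner2: "(\<Sum>x\<in>?V. bit_sign (x \<bullet> w)) = (if w = 0\<^sub>v n then 2 ^ n else 0)" if "w \<in> W" for w
  proof (cases "w = 0\<^sub>v n")
    case True
    then show ?thesis by (simp add: bit_sign_def card_carrier_bit_vec)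
  next
    case False
    have w: "w \<in> ?V" using that WC by blast
    with False obtain i where i: "i < n" "w $ i = 1"
      by (metis bit_not_zero_iff carrier_vecD eq_vecI index_zero_vec(1,2))
    show ?thesis using False
      by (subst sum_bit_sign_eq_0[OF V, of "unit_vec n i"])
        (use w i in \<open>auto simp: add_scalar_prod_distrib[of _ n]\<close>)
  qed
  have "int (card W * card (orth n W)) = (\<Sum>x\<in>?V. if x \<in> orth n W then int (card W) else 0)"
    using fin by (subst sum.inter_filter[symmetric]) (auto simp: orth_def)
  also have "\<dots> = (\<Sum>x\<in>?V. \<Sum>w\<in>W. bit_sign (x \<bullet> w))" using inner1 by simp
  also have "\<dots> = (\<Sum>w\<in>W. \<Sum>x\<in>?V. bit_sign (x \<bullet> w))" by (rule sum.swap)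
  also have "\<dots> = (\<Sum>w\<in>W. if w = 0\<^sub>v n then 2 ^ n else 0)" using inner2 by simp
  also have "\<dots> = 2 ^ n" using fin 0 by (simp add: sum.delta)
  finally show ?thesis by (metis of_nat_eq_iff of_nat_numeral of_nat_power)
qed

text \<open>One inclusion is the symmetry of the scalar product. The count in
  \<open>card_orth\<close>, applied to \<open>W\<close> and to its complement, makes both sides
  equally large.\<close>

lemma orth_orth:
  assumes W: "subgroup W (Z2 n)"
  shows "orth n (orth n W) = W"
proof -
  have WC: "W \<subseteq> carrier_vec n" using subgroup.subset[OF W] by (simp add: monoid_vec_simps)
  have sub: "W \<subseteq> orth n (orth n W)"
    using WC by (auto simp: orth_def) (metis comm_scalar_prod subsetD)
  have "card (orth n W) * card (orth n (orth n W)) = card (orth n W) * card W"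
    using card_orth[OF W] card_orth[OF subgroup_orth[OF WC]] by (simp add: mult.commute)
  moreover have "card (orth n W) \<noteq> 0" using card_orth[OF W] by (metis mult_0_right power_not_zero zero_neq_numeral)
  ultimately have "card (orth n (orth n W)) = card W" by simp
  moreover have "finite (orth n (orth n W))"
    by (rule finite_subset[OF _ finite_carrier_bit_vec[of n]]) (auto simp: orth_def)
  ultimately show ?thesis using card_subset_eq[OF _ sub] by simp
qed

lemma group_hom_mult_mat_vec:
  assumes "A \<in> carrier_mat m n"
  shows "group_hom (Z2 n) (Z2 m) (\<lambda>x. A *\<^sub>v x)"
  using assms
  by (intro group_hom.intro group_hom_axioms.intro comm_group.axioms(2) comm_group_Z2)
    (auto simp: hom_def monoid_vec_simps mult_add_distrib_mat_vec[of _ m n])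

lemma orth_rows:
  assumes A: "A \<in> carrier_mat m n"
  shows "orth n (set (rows A)) = {x \<in> carrier_vec n. A *\<^sub>v x = 0\<^sub>v m}"
proof -
  have "(\<forall>y\<in>set (rows A). x \<bullet> y = 0) \<longleftrightarrow> A *\<^sub>v x = 0\<^sub>v m" if x: "x \<in> carrier_vec n" for x
  proof -
    have "(\<forall>y\<in>set (rows A). x \<bullet> y = 0) \<longleftrightarrow> (\<forall>i<m. row A i \<bullet> x = 0)"
      using A x by (auto simp: rows_def comm_scalar_prod[of x n])
    also have "\<dots> \<longleftrightarrow> A *\<^sub>v x = 0\<^sub>v m"
      using A by (auto simp: vec_eq_iff)
    finally show ?thesis .
  qed
  then show ?thesis by (auto simp: orth_def)
qed


text \<open>The row space is the image of the transpose, hence a subgroup. Its complement is the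
  kernel of \<open>A\<close>, so image times kernel and \<open>card_orth\<close> both give
  \<open>2 ^ n\<close>, and cancelling leaves the size of the column space: row rank equals column
  rank.\<close>

lemma row_space_bit:
  fixes A :: "bit mat"
  assumes A: "A \<in> carrier_mat m n"
  shows "subgroup (vec_space.row_space n A) (Z2 n)"
    and "card (vec_space.row_space n A) = 2 ^ vec_space.rank m A"
proof -
  interpret vec_space "TYPE(bit)" n .
  have rows: "set (rows A) \<subseteq> carrier_vec n" using A by (auto simp: rows_def)
  have orth_eq: "orth n (row_space A) = orth n (set (rows A))"
    unfolding row_space_def using in_orthogonal_complement_span[OF rows] .
  have eq: "row_space A = (\<lambda>y. A\<^sup>T *\<^sub>v y) ` carrier_vec m"
    using A by (auto simp: row_space_eq[OF A])
  interpret T: group_hom "Z2 m" "Z2 n" "\<lambda>y. A\<^sup>T *\<^sub>v y"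
    by (rule group_hom_mult_mat_vec) (use A in simp)
  show sg: "subgroup (row_space A) (Z2 n)"
    using T.img_is_subgroup by (simp add: eq monoid_vec_simps)
  interpret H: group_hom "Z2 n" "Z2 m" "\<lambda>x. A *\<^sub>v x"
    by (rule group_hom_mult_mat_vec) fact
  have "(\<lambda>x. A *\<^sub>v x) ` carrier_vec n = vec_space.col_space m A"
    using A by (auto simp: vec_space.col_space_eq[OF A])
  moreover have "kernel (Z2 n) (Z2 m) (\<lambda>x. A *\<^sub>v x) = orth n (row_space A)"
    unfolding orth_eq orth_rows[OF A] by (simp add: kernel_def monoid_vec_simps)
  ultimately have "2 ^ vec_space.rank m A * card (orth n (row_space A)) = 2 ^ n"
    using H.card_image_kernel
    by (simp add: monoid_vec_simps card_carrier_bit_vec card_col_space_bit[OF A])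
  also have "\<dots> = card (row_space A) * card (orth n (row_space A))"
    using card_orth[OF sg] by simp
  finally show "card (row_space A) = 2 ^ vec_space.rank m A"
    using card_orth[OF sg] by (metis mult_cancel2 mult_0_right power_not_zero zero_neq_numeral)
qed

text \<open>A subgroup of \<open>Z2 n\<close> is already a subspace and so has a basis. It is
  returned as a list to serve as the rows of a matrix, whose kernel depends only on their
  span.\<close>

lemma subgroup_basis_list:
  assumes N: "subgroup N (Z2 n)"
  obtains bs where "set bs \<subseteq> carrier_vec n" and "card N = 2 ^ length bs"
    and "orth n (set bs) = orth n N"
proof -
  interpret vec_space "TYPE(bit)" n .
  have NC: "N \<subseteq> carrier_vec n" using subgroup.subset[OF N] by (simp add: monoid_vec_simps)
  \<comment> \<open>With 0 and 1 as the only scalars, closure under scaling comes from the group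
    structure.\<close>
  have smult: "c \<cdot>\<^sub>v v \<in> N" if "v \<in> N" for c :: bit and v
  proof (cases c)
    case zero
    have "0 \<cdot>\<^sub>v v = 0\<^sub>v n" using that NC by auto
    then show ?thesis using subgroup.one_closed[OF N] zero by (simp add: monoid_vec_simps)
  next
    case one
    then show ?thesis using that by simp
  qed
  have sub: "submodule class_ring N V"
    using NC smult subgroup.one_closed[OF N] subgroup.m_closed[OF N]
    unfolding LinearCombinations.submodule_def
    by (intro conjI vec_module) (auto simp: module_vec_simps monoid_vec_simps)
  have "span N = N"
    using span_is_subset[OF _ sub] in_own_span[of N] NC by auto
  have fin: "finite N" by (rule finite_subset[OF NC finite_carrier_bit_vec])
  have vsN: "vectorspace class_ring (vs N)"
    using span_is_subspace[of N] subspace_is_vs[of N] NC \<open>span N = N\<close> by simp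
  have fdN: "vectorspace.fin_dim class_ring (vs N)"
    using fin_dim_span[OF fin] NC \<open>span N = N\<close> by simp
  obtain \<beta> where \<beta>: "finite \<beta>" "vectorspace.basis class_ring (vs N) \<beta>"
    using vectorspace.finite_basis_exists[OF vsN fdN] by blast
  then have \<beta>N: "\<beta> \<subseteq> N" and gen: "LinearCombinations.module.span class_ring (vs N) \<beta> = N"
    by (simp_all add: vectorspace.basis_def[OF vsN])
  have "span \<beta> = N"
    using gen span_li_not_depend(1)[OF \<beta>N sub] by simp
  obtain bs where bs: "set bs = \<beta>" "distinct bs" using finite_distinct_list[OF \<beta>(1)] by blast
  show ?thesis
  proof
    show "set bs \<subseteq> carrier_vec n" using bs \<beta>N NC by blast
    show "card N = 2 ^ length bs"
      using card_bit_vectorspace[OF vsN fdN]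
        vectorspace.dim_basis[OF vsN \<beta>] bs by (simp add: distinct_card[symmetric])
    show "orth n (set bs) = orth n N"
      using in_orthogonal_complement_span[of \<beta>] \<open>span \<beta> = N\<close> \<beta>N NC bs by auto
  qed
qed

text \<open>The matrix whose rows form a basis of \<open>W\<^sup>\<bottom>\<close> has kernel \<open>W\<^sup>\<bottom>\<^sup>\<bottom> = W\<close> and is surjective by counting.\<close>

lemma quotient_iso_Z2:
  assumes W: "subgroup W (Z2 n)" and card: "card W = 2 ^ d"
  shows "d \<le> n" and "(Z2 n Mod W) \<cong> Z2 (n - d)"
proof -
  have WC: "W \<subseteq> carrier_vec n" using subgroup.subset[OF W] by (simp add: monoid_vec_simps)
  have orth_card: "2 ^ d * card (orth n W) = 2 ^ n" using card_orth[OF W] card by simp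
  then have "(2::nat) ^ d dvd 2 ^ n" by (metis dvd_triv_left)
  then show "d \<le> n" by (simp add: power_dvd_imp_le)
  then have "(2::nat) ^ n = 2 ^ d * 2 ^ (n - d)" by (simp flip: power_add)
  with orth_card have card_orth_W: "card (orth n W) = 2 ^ (n - d)" by simp
  obtain bs where bs: "set bs \<subseteq> carrier_vec n" "card (orth n W) = 2 ^ length bs"
      "orth n (set bs) = orth n (orth n W)"
    using subgroup_basis_list[OF subgroup_orth[OF WC]] by metis
  then have len: "length bs = n - d" using card_orth_W by simp
  let ?P = "mat_of_rows n bs"
  have P: "?P \<in> carrier_mat (n - d) n" using len by auto
  interpret H: group_hom "Z2 n" "Z2 (n - d)" "\<lambda>x. ?P *\<^sub>v x"
    by (rule group_hom_mult_mat_vec[OF P])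
  have ker: "kernel (Z2 n) (Z2 (n - d)) (\<lambda>x. ?P *\<^sub>v x) = W"
    using orth_rows[OF P] bs orth_orth[OF W]
    by (simp add: kernel_def monoid_vec_simps rows_mat_of_rows)
  have "card ((\<lambda>x. ?P *\<^sub>v x) ` carrier (Z2 n)) * 2 ^ d = 2 ^ (n - d) * 2 ^ d"
    using H.card_image_kernel \<open>d \<le> n\<close>
    by (simp add: ker card monoid_vec_simps card_carrier_bit_vec flip: power_add)
  then have "(\<lambda>x. ?P *\<^sub>v x) ` carrier (Z2 n) = carrier (Z2 (n - d))"
    using P by (intro card_subset_eq)
      (auto simp: monoid_vec_simps card_carrier_bit_vec finite_carrier_bit_vec)
  from H.FactGroup_iso[OF this] show "(Z2 n Mod W) \<cong> Z2 (n - d)" by (simp add: ker)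
qed

section \<open>Consistent assignments and the quotient by the row space\<close>

text \<open>For elements of \<open>Z2 k\<close> this is the homomorphism from \<open>Z2 t\<close>
  that sends the unit vector at \<open>j\<close> to \<open>g j\<close>.\<close>

definition assign_mat :: "nat \<Rightarrow> nat \<Rightarrow> (nat \<Rightarrow> bit vec) \<Rightarrow> bit mat" where
  "assign_mat k t g = mat_of_cols k (map g [0..<t])"

lemma assign_mat_carrier [simp]: "assign_mat k t g \<in> carrier_mat k t"
  by (simp add: assign_mat_def mat_of_cols_def)

lemma dim_assign_mat [simp]: "dim_row (assign_mat k t g) = k" "dim_col (assign_mat k t g) = t"
  using assign_mat_carrier[of k t g] by (auto simp del: assign_mat_carrier)

lemma index_assign_mat:
  assumes "i < k" "x \<in> carrier_vec t"
  shows "(assign_mat k t g *\<^sub>v x) $ i = (\<Sum>j<t. x $ j * g j $ i)"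
  using assms by (simp add: assign_mat_def scalar_prod_def mat_of_cols_def atLeast0LessThan mult.commute)

lemma assign_mat_closed [simp]:
  "x \<in> carrier_vec t \<Longrightarrow> assign_mat k t g *\<^sub>v x \<in> carrier_vec k"
  using mult_mat_vec_carrier[OF assign_mat_carrier] .

text \<open>A sum of group elements is the form to which homomorphisms and the closure of a
  generated subgroup apply.\<close>

lemma assign_mat_eq_finsum:
  assumes g: "\<And>j. j < t \<Longrightarrow> g j \<in> carrier_vec k" and x: "x \<in> carrier_vec t"
  shows "assign_mat k t g *\<^sub>v x = finsum_vec TYPE(bit) k (\<lambda>j. x $ j \<cdot>\<^sub>v g j) {..<t}"
proof (rule eq_vecI)
  have cl: "finsum_vec TYPE(bit) k (\<lambda>j. x $ j \<cdot>\<^sub>v g j) {..<t} \<in> carrier_vec k"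
    by (rule finsum_vec_closed) (use g in auto)
  show "dim_vec (assign_mat k t g *\<^sub>v x) = dim_vec (finsum_vec TYPE(bit) k (\<lambda>j. x $ j \<cdot>\<^sub>v g j) {..<t})"
    using cl by (simp add: assign_mat_def)
  fix i assume "i < dim_vec (finsum_vec TYPE(bit) k (\<lambda>j. x $ j \<cdot>\<^sub>v g j) {..<t})"
  with cl have i: "i < k" by simp
  have "finsum_vec TYPE(bit) k (\<lambda>j. x $ j \<cdot>\<^sub>v g j) {..<t} $ i = (\<Sum>j<t. (x $ j \<cdot>\<^sub>v g j) $ i)"
    using g i by (intro index_finsum_vec) auto
  also have "\<dots> = (\<Sum>j<t. x $ j * g j $ i)"
    using i by (intro sum.cong) (auto simp: carrier_vecD[OF g])
  finally show "(assign_mat k t g *\<^sub>v x) $ i = finsum_vec TYPE(bit) k (\<lambda>j. x $ j \<cdot>\<^sub>v g j) {..<t} $ i"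
    using i x by (simp add: index_assign_mat del: index_mult_mat_vec)
qed

lemma assign_mat_unit_vec:
  assumes g: "g j \<in> carrier_vec k" and j: "j < t"
  shows "assign_mat k t g *\<^sub>v unit_vec t j = g j"
proof (rule eq_vecI)
  fix i assume "i < dim_vec (g j)"
  then have "i < k" using carrier_vecD[OF g] by simp
  then have "(assign_mat k t g *\<^sub>v unit_vec t j) $ i = (\<Sum>l<t. unit_vec t j $ l * g l $ i)"
    by (simp add: index_assign_mat del: index_mult_mat_vec)
  also have "\<dots> = (\<Sum>l<t. if l = j then g j $ i else 0)"
    using j by (intro sum.cong) auto
  also have "\<dots> = g j $ i" using j by simp
  finally show "(assign_mat k t g *\<^sub>v unit_vec t j) $ i = g j $ i" .
qed (use g in auto)

text \<open>The matrix is the identity; this expands \<open>x\<close> in unit vectors for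
  \<open>hom_eq_assign_mat\<close>.\<close>

lemma assign_mat_unit_vecs:
  assumes x: "x \<in> carrier_vec t"
  shows "assign_mat t t (unit_vec t) *\<^sub>v x = x"
proof (rule eq_vecI)
  fix i assume "i < dim_vec x"
  then have i: "i < t" using x by simp
  then have "(assign_mat t t (unit_vec t) *\<^sub>v x) $ i = (\<Sum>l<t. x $ l * unit_vec t l $ i)"
    by (simp only: index_assign_mat x)
  also have "\<dots> = (\<Sum>l<t. if l = i then x $ i else 0)"
    using i by (intro sum.cong) auto
  also have "\<dots> = x $ i" using i by simp
  finally show "(assign_mat t t (unit_vec t) *\<^sub>v x) $ i = x $ i" .
qed (use x in auto)

section \<open>Homomorphisms of \<open>Z2 n\<close> as matrices\<close>

lemma hom_Z2_zero:
  assumes "h \<in> hom (Z2 n) (Z2 m)"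
  shows "h (0\<^sub>v n) = 0\<^sub>v m"
  using hom_one[OF assms comm_group.axioms(2)[OF comm_group_Z2] comm_group.axioms(2)[OF comm_group_Z2]]
  by (simp add: monoid_vec_simps)

lemma hom_Z2_closed:
  "h \<in> hom (Z2 n) (Z2 m) \<Longrightarrow> v \<in> carrier_vec n \<Longrightarrow> h v \<in> carrier_vec m"
  by (drule hom_in_carrier) (auto simp: monoid_vec_simps)

lemma hom_Z2_add:
  "h \<in> hom (Z2 n) (Z2 m) \<Longrightarrow> v \<in> carrier_vec n \<Longrightarrow> w \<in> carrier_vec n \<Longrightarrow> h (v + w) = h v + h w"
  by (drule hom_mult) (auto simp: monoid_vec_simps)

text \<open>The only scalars are 0 and 1, so additivity alone gives linearity.\<close>

lemma hom_Z2_smult: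
  assumes h: "h \<in> hom (Z2 n) (Z2 m)" and v: "v \<in> carrier_vec n"
  shows "h (b \<cdot>\<^sub>v v) = b \<cdot>\<^sub>v h v"
proof (cases b)
  case zero
  have "0 \<cdot>\<^sub>v v = 0\<^sub>v n" "0 \<cdot>\<^sub>v h v = 0\<^sub>v m" using v hom_Z2_closed[OF h v] by auto
  then show ?thesis by (simp add: zero hom_Z2_zero[OF h])
qed simp

lemma hom_Z2_finsum:
  assumes h: "h \<in> hom (Z2 n) (Z2 m)" and "finite S" and "f \<in> S \<rightarrow> carrier_vec n"
  shows "h (finsum_vec TYPE(bit) n f S) = finsum_vec TYPE(bit) m (\<lambda>s. h (f s)) S"
  using assms(2,3)
proof (induction S)
  case empty
  show ?case by (simp add: finsum_vec_empty hom_Z2_zero[OF h])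
next
  case (insert s S)
  then have f: "f \<in> S \<rightarrow> carrier_vec n" "f s \<in> carrier_vec n" by auto
  then have hf: "(\<lambda>s. h (f s)) \<in> S \<rightarrow> carrier_vec m" "h (f s) \<in> carrier_vec m"
    using hom_Z2_closed[OF h] by auto
  show ?case
    using insert f hf
    by (simp add: finsum_vec_insert hom_Z2_add[OF h] finsum_vec_closed)
qed

lemma hom_assign_mat:
  assumes h: "h \<in> hom (Z2 k) (Z2 m)" and g: "\<And>j. j < t \<Longrightarrow> g j \<in> carrier_vec k"
    and x: "x \<in> carrier_vec t"
  shows "h (assign_mat k t g *\<^sub>v x) = assign_mat m t (\<lambda>j. h (g j)) *\<^sub>v x"
proof -
  have hg: "h (g j) \<in> carrier_vec m" if "j < t" for j using hom_Z2_closed[OF h g[OF that]] .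
  have "h (finsum_vec TYPE(bit) k (\<lambda>j. x $ j \<cdot>\<^sub>v g j) {..<t})
      = finsum_vec TYPE(bit) m (\<lambda>j. h (x $ j \<cdot>\<^sub>v g j)) {..<t}"
    by (rule hom_Z2_finsum[OF h]) (use g in auto)
  also have "\<dots> = finsum_vec TYPE(bit) m (\<lambda>j. x $ j \<cdot>\<^sub>v h (g j)) {..<t}"
    unfolding finsum_vec_def
    by (rule comm_monoid.finprod_cong[OF comm_monoid_vec])
      (use g hg in \<open>auto simp: hom_Z2_smult[OF h] monoid_vec_simps simp_implies_def\<close>)
  finally show ?thesis using g hg x by (simp add: assign_mat_eq_finsum)
qed

lemma hom_eq_assign_mat:
  assumes h: "h \<in> hom (Z2 t) (Z2 k)" and x: "x \<in> carrier_vec t"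
  shows "h x = assign_mat k t (\<lambda>j. h (unit_vec t j)) *\<^sub>v x"
  using hom_assign_mat[OF h, of t "unit_vec t" x] x by (simp add: assign_mat_unit_vecs)

text \<open>Allows the linear map demanded by \<open>linear_image\<close> to be built and used as a
  group homomorphism.\<close>

lemma linear_map_iff_hom:
  "linear_map class_ring (module_vec TYPE(bit) k) (module_vec TYPE(bit) m) T \<longleftrightarrow> T \<in> hom (Z2 k) (Z2 m)"
proof
  assume "linear_map class_ring (module_vec TYPE(bit) k) (module_vec TYPE(bit) m) T"
  then interpret linear_map class_ring "module_vec TYPE(bit) k" "module_vec TYPE(bit) m" T .
  show "T \<in> hom (Z2 k) (Z2 m)"
    using T_im T_add by (auto simp: hom_def module_vec_simps monoid_vec_simps)
next
  assume T: "T \<in> hom (Z2 k) (Z2 m)"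
  show "linear_map class_ring (module_vec TYPE(bit) k) (module_vec TYPE(bit) m) T"
    unfolding linear_map_def mod_hom_def mod_hom_axioms_def LinearCombinations.module_hom_def
    using hom_Z2_closed[OF T] hom_Z2_add[OF T] hom_Z2_smult[OF T]
    by (auto simp: vec_vs vec_module module_vec_simps)
qed

text \<open>The span of the assigned elements is the column space of their matrix, which is also its
  image.\<close>

lemma assignment_dim_eq:
  assumes g: "\<And>j. j < t \<Longrightarrow> g j \<in> carrier_vec k"
  shows "2 ^ assignment_dim t k g = card ((\<lambda>x. assign_mat k t g *\<^sub>v x) ` carrier_vec t)"
proof -
  have cols: "set (cols (assign_mat k t g)) = g ` {..<t}"
    using g by (subst assign_mat_def, subst cols_mat_of_cols) (auto simp: atLeast0LessThan)
  have "(\<lambda>x. assign_mat k t g *\<^sub>v x) ` carrier_vec t = vec_space.col_space k (assign_mat k t g)"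
    unfolding vec_space.col_space_eq[OF assign_mat_carrier] by auto
  then show ?thesis
    using card_col_space_bit[OF assign_mat_carrier[of k t g]]
    by (simp add: assignment_dim_def vec_space.rank_def cols)
qed

section \<open>Class parities of edge sets\<close>

locale partitioned_graph =
  fixes G :: "'v ugraph" and F :: "nat \<Rightarrow> 'v set set" and t :: nat
  assumes simple: "simple_graph G" and finite_verts: "finite (verts G)"
    and F_inj: "inj_on F {..<t}" and F_part: "partition_on (edges G) (F ` {..<t})"
begin

lemma finite_edges: "finite (edges G)"
  by (rule finite_subset[of _ "Pow (verts G)"]) (use simple finite_verts in \<open>auto simp: simple_graph_def\<close>)

text \<open>Blocks that share an edge coincide as sets, and injectivity of \<open>F\<close> then
  identifies their indices.\<close>

lemma edge_class_eq:
  assumes "j < t" "e \<in> F j"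
  shows "edge_class F t e = j"
  unfolding edge_class_def
proof (rule the_equality)
  fix i assume i: "i < t \<and> e \<in> F i"
  then have "F i = F j"
    using assms partition_onD2[OF F_part] by (auto simp: disjoint_def)
  then show "i = j" using F_inj i assms by (auto dest: inj_onD)
qed (use assms in simp)

lemma edge_class_props:
  assumes "e \<in> edges G"
  shows "edge_class F t e < t" and "e \<in> F (edge_class F t e)"
proof -
  obtain j where "j < t" "e \<in> F j"
    using assms partition_onD1[OF F_part] by auto
  then show "edge_class F t e < t" "e \<in> F (edge_class F t e)" by (auto simp: edge_class_eq)
qed

lemma F_subset_edges: "j < t \<Longrightarrow> F j \<subseteq> edges G"
  using partition_onD1[OF F_part] by auto

text \<open>A row of the parity matrix, with an arbitrary vertex list in place of a basis
  cycle.\<close>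

definition parity_vec :: "'v list \<Rightarrow> bit vec" where
  "parity_vec p = vec t (\<lambda>j. of_nat (card (F j \<inter> walk_edges p)))"

lemma parity_vec_carrier [simp]: "parity_vec p \<in> carrier_vec t"
  by (simp add: parity_vec_def)

text \<open>Grouping the edges by class, class \<open>j\<close> contributes as many copies of
  \<open>g j\<close> as it has edges in \<open>p\<close>, and only the parity of that number
  matters.\<close>

lemma class_sum_eq_assign_mat:
  assumes p: "walk_edges p \<subseteq> edges G" and g: "\<And>j. j < t \<Longrightarrow> g j \<in> carrier_vec k"
  shows "class_sum F t k g p = assign_mat k t g *\<^sub>v parity_vec p"
proof (rule eq_vecI)
  let ?c = "edge_class F t"
  have fin: "finite (walk_edges p)" using finite_subset[OF p finite_edges] .
  have gc: "g (?c e) \<in> carrier_vec k" if "e \<in> walk_edges p" for e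
    using that p edge_class_props(1) g by blast
  have cl: "class_sum F t k g p \<in> carrier_vec k"
    unfolding class_sum_def by (rule finsum_vec_closed) (use gc in auto)
  show "dim_vec (class_sum F t k g p) = dim_vec (assign_mat k t g *\<^sub>v parity_vec p)"
    using cl by simp
  fix i assume "i < dim_vec (assign_mat k t g *\<^sub>v parity_vec p)"
  then have i: "i < k" by simp
  have fib: "{e \<in> walk_edges p. ?c e = j} = F j \<inter> walk_edges p" if "j < t" for j
    using that p edge_class_props(2) edge_class_eq by blast
  have "class_sum F t k g p $ i = (\<Sum>e\<in>walk_edges p. g (?c e) $ i)"
    unfolding class_sum_def using fin i gc by (intro index_finsum_vec) auto
  also have "\<dots> = (\<Sum>j<t. \<Sum>e | e \<in> walk_edges p \<and> ?c e = j. g (?c e) $ i)"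
    using fin p edge_class_props(1) by (intro sum.group[symmetric]) auto
  also have "\<dots> = (\<Sum>j<t. parity_vec p $ j * g j $ i)"
    by (intro sum.cong) (auto simp: parity_vec_def simp flip: fib)
  also have "\<dots> = (assign_mat k t g *\<^sub>v parity_vec p) $ i"
    using i by (simp add: index_assign_mat del: index_mult_mat_vec)
  finally show "class_sum F t k g p $ i = (assign_mat k t g *\<^sub>v parity_vec p) $ i" .
qed

end

lemma walk_edges_Cons [simp]: "walk_edges (u # v # p) = insert {u, v} (walk_edges (v # p))"
  by (simp add: walk_edges_def)

lemma walk_edges_subset_edges: "walk G p \<Longrightarrow> walk_edges p \<subseteq> edges G"
proof (induction p rule: induct_list012)
  case (3 u v p)
  then show ?case by (auto simp: walk_def)
qed (auto simp: walk_edges_def)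

lemma cycle_walk: "cycle G p \<Longrightarrow> walk G p"
  by (simp add: cycle_def)

section \<open>Parity vectors of cycles and the row space\<close>

locale parity_graph = partitioned_graph +
  fixes B :: "nat \<Rightarrow> 'a list"
  assumes basis: "cycle_basis G B"
begin

abbreviation A where "A \<equiv> parity_matrix G F t B"

definition R where "R = vec_space.row_space t A"

lemma A_carrier: "A \<in> carrier_mat (cycle_rank G) t"
  by (simp add: parity_matrix_def)

lemma R_subgroup: "subgroup R (Z2 t)"
  unfolding R_def by (rule row_space_bit(1)[OF A_carrier])

lemma row_A: "i < cycle_rank G \<Longrightarrow> row A i = parity_vec (B i)"
  by (intro eq_vecI) (auto simp: parity_matrix_def parity_vec_def)

lemma rows_A_subset_R: "set (rows A) \<subseteq> R"
proof -
  interpret vec_space "TYPE(bit)" t .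
  show ?thesis unfolding R_def row_space_def
    by (rule in_own_span) (use A_carrier in \<open>auto simp: rows_def\<close>)
qed

text \<open>The edge functions whose parity vector lies in \<open>R\<close> form a subspace. It
  contains the basis cycles, whose parity vectors are rows of \<open>A\<close>, and hence the whole
  cycle space.\<close>

lemma cycle_parity_in_R:
  assumes "cycle G p"
  shows "parity_vec p \<in> R"
proof -
  \<comment> \<open>The parity map is extended from edge sets to all \<open>bit\<close>-valued
    functions, where it is linear.\<close>
  let ?\<Pi> = "\<lambda>f :: 'a set \<Rightarrow> bit. vec t (\<lambda>j. \<Sum>e\<in>F j. f e)"
  have \<Pi>_ind: "?\<Pi> (indicator (walk_edges q)) = parity_vec q" for q
  proof (rule eq_vecI)
    fix j assume "j < dim_vec (parity_vec q)"
    then have j: "j < t" by (simp add: parity_vec_def)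
    then have "finite (F j)" using F_subset_edges finite_edges finite_subset by blast
    then show "?\<Pi> (indicator (walk_edges q)) $ j = parity_vec q $ j"
      using j by (simp add: parity_vec_def indicator_def sum.If_cases)
  qed (simp add: parity_vec_def)
  let ?b = "(\<lambda>i. indicator (walk_edges (B i))) ` {..<cycle_rank G} :: ('a set \<Rightarrow> bit) set"
  have b: "edge_space.span ?b = cycle_space G"
    using basis by (auto simp: cycle_basis_def Let_def)
  have "edge_space.span ?b \<subseteq> {f. ?\<Pi> f \<in> R}"
  proof (rule edge_space.span_minimal)
    show "?b \<subseteq> {f. ?\<Pi> f \<in> R}"
    proof clarify
      fix i assume i: "i < cycle_rank G"
      then have "row A i \<in> set (rows A)" using A_carrier by (auto simp: rows_def)
      then show "?\<Pi> (indicator (walk_edges (B i))) \<in> R"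
        using rows_A_subset_R row_A[OF i] by (auto simp: \<Pi>_ind)
    qed
    have 0: "0\<^sub>v t \<in> R" using subgroup.one_closed[OF R_subgroup] by (simp add: monoid_vec_simps)
    have add: "v + w \<in> R" if "v \<in> R" "w \<in> R" for v w
      using subgroup.m_closed[OF R_subgroup that] by (simp add: monoid_vec_simps)
    show "edge_space.subspace {f. ?\<Pi> f \<in> R}"
    proof (rule edge_space.subspaceI)
      have "?\<Pi> 0 = 0\<^sub>v t" by (intro eq_vecI) auto
      then show "0 \<in> {f. ?\<Pi> f \<in> R}" using 0 by simp
    next
      fix f g assume fg: "f \<in> {f. ?\<Pi> f \<in> R}" "g \<in> {f. ?\<Pi> f \<in> R}"
      have "?\<Pi> (f + g) = ?\<Pi> f + ?\<Pi> g" by (intro eq_vecI) (auto simp: sum.distrib)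
      then show "f + g \<in> {f. ?\<Pi> f \<in> R}" using fg add by simp
    next
      fix c :: bit and f assume f: "f \<in> {f. ?\<Pi> f \<in> R}"
      have "?\<Pi> (\<lambda>e. c * f e) = (if c = 0 then 0\<^sub>v t else ?\<Pi> f)" by (intro eq_vecI) auto
      then show "(\<lambda>e. c * f e) \<in> {f. ?\<Pi> f \<in> R}" using f 0 by simp
    qed
  qed
  moreover have "indicator (walk_edges p) \<in> cycle_space G"
    unfolding cycle_space_def using assms by (intro edge_space.span_base) auto
  ultimately show ?thesis using b \<Pi>_ind by auto
qed

text \<open>Killing \<open>R\<close> suffices because \<open>R\<close> contains all cycle parities.
  Conversely the basis cycles alone force the matrix of \<open>g\<close> to kill the rows of
  \<open>A\<close>, and so their span.\<close>

lemma consistent_iff: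
  "consistent G F t k g \<longleftrightarrow>
     (\<forall>j<t. g j \<in> carrier_vec k) \<and> (\<forall>x\<in>R. assign_mat k t g *\<^sub>v x = 0\<^sub>v k)"
proof -
  have "(\<forall>p. cycle G p \<longrightarrow> class_sum F t k g p = 0\<^sub>v k) \<longleftrightarrow>
      (\<forall>x\<in>R. assign_mat k t g *\<^sub>v x = 0\<^sub>v k)" if g: "\<forall>j<t. g j \<in> carrier_vec k"
  proof
    assume *: "\<forall>x\<in>R. assign_mat k t g *\<^sub>v x = 0\<^sub>v k"
    show "\<forall>p. cycle G p \<longrightarrow> class_sum F t k g p = 0\<^sub>v k"
      using * g cycle_parity_in_R
      by (auto simp: class_sum_eq_assign_mat walk_edges_subset_edges[OF cycle_walk])
  next
    assume *: "\<forall>p. cycle G p \<longrightarrow> class_sum F t k g p = 0\<^sub>v k"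
    let ?M = "assign_mat k t g"
    have A_row_zero: "?M *\<^sub>v row A i = 0\<^sub>v k" if i: "i < cycle_rank G" for i
    proof -
      have "cycle G (B i)" using basis i by (simp add: cycle_basis_def)
      then show ?thesis
        using * g class_sum_eq_assign_mat[OF walk_edges_subset_edges[OF cycle_walk], of "B i" g k]
        by (simp add: row_A i)
    qed
    \<comment> \<open>Elements of \<open>R\<close> are images under the transpose of
      \<open>A\<close>, so one matrix product covers all of them.\<close>
    have prod: "?M * A\<^sup>T = 0\<^sub>m k (cycle_rank G)"
    proof (rule eq_matI)
      fix i j assume ij: "i < dim_row (0\<^sub>m k (cycle_rank G) :: bit mat)"
        "j < dim_col (0\<^sub>m k (cycle_rank G) :: bit mat)"
      then have "(?M * A\<^sup>T) $$ (i, j) = (?M *\<^sub>v row A j) $ i"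
        using A_carrier by simp
      also have "\<dots> = 0" using ij by (subst A_row_zero) auto
      finally show "(?M * A\<^sup>T) $$ (i, j) = 0\<^sub>m k (cycle_rank G) $$ (i, j)" using ij by simp
    qed (use A_carrier in auto)
    show "\<forall>x\<in>R. ?M *\<^sub>v x = 0\<^sub>v k"
    proof
      fix x assume "x \<in> R"
      then obtain y where y: "y \<in> carrier_vec (cycle_rank G)" "x = A\<^sup>T *\<^sub>v y"
        using A_carrier by (auto simp: R_def vec_space.row_space_eq[OF A_carrier])
      have "?M *\<^sub>v x = (?M * A\<^sup>T) *\<^sub>v y"
        using A_carrier y by (subst assoc_mult_mat_vec[of _ k t _ "cycle_rank G"]) auto
      also have "\<dots> = 0\<^sub>v k" using y unfolding prod by (intro eq_vecI) (auto simp: scalar_prod_def)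
      finally show "?M *\<^sub>v x = 0\<^sub>v k" .
    qed
  qed
  then show ?thesis by (auto simp: consistent_def)
qed

end

section \<open>Universal property of the quotient\<close>

text \<open>Composing \<open>\<phi>\<close> with the coset projection gives a surjective
  homomorphism with kernel \<open>W\<close>; these properties are all that
  \<open>most_generic_quotient\<close> asks of \<open>h\<close>.\<close>

lemma iso_quotient_hom:
  assumes W: "subgroup W (Z2 n)" and \<phi>: "\<phi> \<in> iso (Z2 n Mod W) (Z2 k)"
  defines "h \<equiv> \<lambda>x. \<phi> (W #>\<^bsub>Z2 n\<^esub> x)"
  shows "h \<in> hom (Z2 n) (Z2 k)" and "h ` carrier_vec n = carrier_vec k"
    and "x \<in> carrier_vec n \<Longrightarrow> h x = 0\<^sub>v k \<longleftrightarrow> x \<in> W"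
proof -
  interpret Z: comm_group "Z2 n" by (rule comm_group_Z2)
  interpret K: comm_group "Z2 k" by (rule comm_group_Z2)
  interpret N: normal W "Z2 n" by (rule Z.subgroup_imp_normal[OF W])
  have \<phi>_hom: "\<phi> \<in> hom (Z2 n Mod W) (Z2 k)" and \<phi>_bij: "bij_betw \<phi> (carrier (Z2 n Mod W)) (carrier (Z2 k))"
    using \<phi> by (auto simp: iso_def)
  have car: "carrier (Z2 n Mod W) = (\<lambda>x. W #>\<^bsub>Z2 n\<^esub> x) ` carrier_vec n"
    by (auto simp: FactGroup_def RCOSETS_def monoid_vec_simps)
  have "\<phi> \<circ> (\<lambda>x. W #>\<^bsub>Z2 n\<^esub> x) \<in> hom (Z2 n) (Z2 k)"
    by (rule hom_compose[OF N.r_coset_hom_Mod \<phi>_hom])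
  then show "h \<in> hom (Z2 n) (Z2 k)" by (simp add: h_def comp_def)
  show "h ` carrier_vec n = carrier_vec k"
    using \<phi>_bij car by (auto simp: h_def bij_betw_def monoid_vec_simps image_image)
  assume x: "x \<in> carrier_vec n"
  have 1: "\<phi> W = 0\<^sub>v k"
    using hom_one[OF \<phi>_hom N.factorgroup_is_group K.is_group] by (simp add: FactGroup_def monoid_vec_simps)
  have "h x = 0\<^sub>v k \<longleftrightarrow> W #>\<^bsub>Z2 n\<^esub> x = W"
  proof
    assume "h x = 0\<^sub>v k"
    then have "\<phi> (W #>\<^bsub>Z2 n\<^esub> x) = \<phi> W" by (simp add: h_def 1)
    moreover have "W \<in> carrier (Z2 n Mod W)" using N.subgroup_in_rcosets by (simp add: FactGroup_def Z.is_group)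
    ultimately show "W #>\<^bsub>Z2 n\<^esub> x = W"
      using \<phi>_bij x car by (auto simp: bij_betw_def dest: inj_onD)
  qed (simp add: h_def 1)
  also have "\<dots> \<longleftrightarrow> x \<in> W"
    using x Z.coset_join1[of W x] Z.coset_join2[of x W] W by (auto simp: monoid_vec_simps)
  finally show "h x = 0\<^sub>v k \<longleftrightarrow> x \<in> W" .
qed

text \<open>\<open>T\<close> maps the image of the first matrix onto the image of the second, which
  therefore has no more elements.\<close>

lemma assignment_dim_linear_image_le:
  assumes g: "\<And>j. j < t \<Longrightarrow> g j \<in> carrier_vec k" and "linear_image t k g k' g'"
  shows "assignment_dim t k' g' \<le> assignment_dim t k g"
proof -
  obtain T where T: "T \<in> hom (Z2 k) (Z2 k')" and g': "\<And>j. j < t \<Longrightarrow> g' j = T (g j)"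
    using assms(2) by (auto simp: linear_image_def linear_map_iff_hom)
  have g'_car: "g' j \<in> carrier_vec k'" if "j < t" for j
    using that g hom_Z2_closed[OF T] by (simp add: g')
  have "assign_mat k' t g' = assign_mat k' t (\<lambda>j. T (g j))"
    unfolding assign_mat_def by (auto simp: g' intro!: arg_cong[where f = "mat_of_cols k'"])
  then have "(\<lambda>x. assign_mat k' t g' *\<^sub>v x) ` carrier_vec t
      = T ` (\<lambda>x. assign_mat k t g *\<^sub>v x) ` carrier_vec t"
    by (auto simp: hom_assign_mat[OF T g] image_image)
  then have "card ((\<lambda>x. assign_mat k' t g' *\<^sub>v x) ` carrier_vec t)
      \<le> card ((\<lambda>x. assign_mat k t g *\<^sub>v x) ` carrier_vec t)"
    by (simp add: card_image_le finite_carrier_bit_vec)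
  then have "(2::nat) ^ assignment_dim t k' g' \<le> 2 ^ assignment_dim t k g"
    using assignment_dim_eq[OF g] assignment_dim_eq[OF g'_car] by simp
  then show ?thesis by simp
qed

text \<open>Each of the two assignments is a linear image of the other.\<close>

lemma most_generic_dim_unique:
  assumes "most_generic G F t k g" "most_generic G F t k' g'"
  shows "assignment_dim t k' g' = assignment_dim t k g"
  using assms
  by (intro antisym; intro assignment_dim_linear_image_le) (auto simp: most_generic_def consistent_def)

context parity_graph
begin

text \<open>The matrix of \<open>g\<close> acts as \<open>h\<close>, so surjectivity gives the
  dimension and the kernel gives consistency. The matrix of any other consistent assignment kills
  \<open>R\<close>, the kernel of \<open>h\<close>, and thus factors through \<open>h\<close>; the
  factor is \<open>T\<close>.\<close>

lemma most_generic_quotient: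
  assumes h: "h \<in> hom (Z2 t) (Z2 k)" and surj: "h ` carrier_vec t = carrier_vec k"
    and ker: "\<And>x. x \<in> carrier_vec t \<Longrightarrow> h x = 0\<^sub>v k \<longleftrightarrow> x \<in> R"
  defines "g \<equiv> \<lambda>j. h (unit_vec t j)"
  shows "most_generic G F t k g" and "assignment_dim t k g = k"
proof -
  have g: "g j \<in> carrier_vec k" for j
    unfolding g_def by (rule hom_Z2_closed[OF h]) simp
  have hg: "assign_mat k t g *\<^sub>v x = h x" if "x \<in> carrier_vec t" for x
    using hom_eq_assign_mat[OF h that] by (simp add: g_def)
  have RC: "R \<subseteq> carrier_vec t" using subgroup.subset[OF R_subgroup] by (simp add: monoid_vec_simps)
  have "(\<lambda>x. assign_mat k t g *\<^sub>v x) ` carrier_vec t = carrier_vec k"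
    using surj hg by (metis (no_types, lifting) image_cong)
  then have "(2::nat) ^ assignment_dim t k g = 2 ^ k"
    using assignment_dim_eq[of t g k] g by (simp add: card_carrier_bit_vec)
  then show "assignment_dim t k g = k" by simp
  have "consistent G F t k g"
    unfolding consistent_iff using g hg ker RC by auto
  moreover have "linear_image t k g k' g'" if "consistent G F t k' g'" for k' g'
  proof -
    have g': "g' j \<in> carrier_vec k'" if "j < t" for j
      using that \<open>consistent G F t k' g'\<close> by (simp add: consistent_def)
    let ?M = "\<lambda>x. assign_mat k' t g' *\<^sub>v x"
    \<comment> \<open>Any preimage under \<open>h\<close> may be chosen: two of them differ by an element of \<open>R\<close>.\<close>
    define T where "T y = ?M (SOME x. x \<in> carrier_vec t \<and> h x = y)" for y
    have T_h: "T (h x) = ?M x" if x: "x \<in> carrier_vec t" for x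
    proof -
      define z where "z = (SOME z. z \<in> carrier_vec t \<and> h z = h x)"
      have z: "z \<in> carrier_vec t" "h z = h x"
        using someI[of "\<lambda>z. z \<in> carrier_vec t \<and> h z = h x" x] x by (auto simp: z_def)
      \<comment> \<open>In characteristic two the sum \<open>z + x\<close> is also the difference of
        the two preimages.\<close>
      have "h (z + x) = 0\<^sub>v k"
        using z x hom_Z2_closed[OF h x] by (simp add: hom_Z2_add[OF h] add_self_bit_vec)
      then have "z + x \<in> R" using ker z x by simp
      then have "?M (z + x) = 0\<^sub>v k'" using \<open>consistent G F t k' g'\<close> by (simp add: consistent_iff)
      then have 0: "?M z + ?M x = 0\<^sub>v k'"
        using z x by (simp add: mult_add_distrib_mat_vec[OF assign_mat_carrier])
      have "?M z = ?M z + (?M x + ?M x)"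
        using z x by (simp add: add_self_bit_vec[of _ k'])
      also have "\<dots> = (?M z + ?M x) + ?M x"
        using z x by (intro assoc_add_vec[symmetric, of _ k']) auto
      also have "\<dots> = ?M x" using x by (simp add: 0)
      finally show ?thesis unfolding T_def z_def[symmetric] .
    qed
    have "T \<in> hom (Z2 k) (Z2 k')"
    proof (rule homI)
      fix y assume "y \<in> carrier (Z2 k)"
      then obtain x where "x \<in> carrier_vec t" "y = h x" using surj by (auto simp: monoid_vec_simps)
      then show "T y \<in> carrier (Z2 k')" by (simp add: T_h monoid_vec_simps)
    next
      fix y y' assume "y \<in> carrier (Z2 k)" "y' \<in> carrier (Z2 k)"
      then obtain x x' where x: "x \<in> carrier_vec t" "y = h x" "x' \<in> carrier_vec t" "y' = h x'"
        using surj by (metis imageE monoid_vec_simps(2))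
      have "T (y + y') = T (h (x + x'))" using x by (simp add: hom_Z2_add[OF h])
      also have "\<dots> = T y + T y'"
        using x T_h[of "x + x'"] by (simp add: T_h mult_add_distrib_mat_vec[OF assign_mat_carrier])
      finally show "T (y \<otimes>\<^bsub>Z2 k\<^esub> y') = T y \<otimes>\<^bsub>Z2 k'\<^esub> T y'" by (simp add: monoid_vec_simps)
    qed
    moreover have "g' j = T (g j)" if "j < t" for j
      using that by (simp add: g_def T_h assign_mat_unit_vec g')
    ultimately show ?thesis by (auto simp: linear_image_def linear_map_iff_hom)
  qed
  ultimately show "most_generic G F t k g" by (simp add: most_generic_def)
qed

end

section \<open>Walk sums\<close>

lemma walk_edges_subset: "e \<in> walk_edges p \<Longrightarrow> e \<subseteq> set p"
  by (induction p rule: induct_list012) (auto simp: walk_edges_def)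

lemma finite_walk_edges [simp]: "finite (walk_edges p)"
  by (simp add: walk_edges_def)

lemma walk_single [simp]: "walk G [u] \<longleftrightarrow> u \<in> verts G"
  by (simp add: walk_def)

lemma walk_Cons: "walk G (u # v # p) \<longleftrightarrow> u \<in> verts G \<and> {u, v} \<in> edges G \<and> walk G (v # p)"
  by (auto simp: walk_def)

text \<open>The two pieces share the vertex \<open>v\<close>, so no edge is lost in the
  split.\<close>

lemma walk_append: "walk G (p @ v # q) \<longleftrightarrow> walk G (p @ [v]) \<and> walk G (v # q)"
  by (auto simp: walk_def successively_append_iff successively_Cons)

lemma walk_rev [simp]: "walk G (rev p) \<longleftrightarrow> walk G p"
  by (auto simp: walk_def insert_commute)

text \<open>Unlike \<open>class_sum\<close>, this counts every traversal of an edge and is therefore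
  additive under concatenation. Weights in \<open>bit\<close> suffice, as vectors are treated one
  coordinate at a time.\<close>

definition walk_sum :: "('v set \<Rightarrow> bit) \<Rightarrow> 'v list \<Rightarrow> bit" where
  "walk_sum w p = (\<Sum>(u, v)\<leftarrow>zip p (tl p). w {u, v})"

lemma walk_sum_single [simp]: "walk_sum w [u] = 0"
  by (simp add: walk_sum_def)

lemma walk_sum_Cons [simp]: "walk_sum w (u # v # p) = w {u, v} + walk_sum w (v # p)"
  by (simp add: walk_sum_def)

lemma walk_sum_append: "walk_sum w (p @ v # q) = walk_sum w (p @ [v]) + walk_sum w (v # q)"
proof (induction p rule: induct_list012)
  case (2 u)
  show ?case by (simp add: add.assoc)
qed (simp_all add: add.assoc)

lemma walk_sum_rev: "walk_sum w (rev p) = walk_sum w p"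
proof (induction p rule: induct_list012)
  case (3 u v p)
  have "walk_sum w (rev (u # v # p)) = walk_sum w (rev p @ v # [u])" by simp
  also have "\<dots> = walk_sum w (rev (v # p)) + w {v, u}"
    by (subst walk_sum_append) simp
  finally show ?case using 3 by (simp add: insert_commute add.commute)
qed (simp_all add: walk_sum_def)

lemma walk_sum_distinct: "distinct p \<Longrightarrow> walk_sum w p = (\<Sum>e\<in>walk_edges p. w e)"
proof (induction p rule: induct_list012)
  case (3 u v p)
  then have "{u, v} \<notin> walk_edges (v # p)" using walk_edges_subset by fastforce
  then show ?case using 3 by simp
qed (simp_all add: walk_sum_def walk_edges_def)

text \<open>The tail is a path, so it only remains to see that the first edge does not recur in
  it.\<close>

lemma walk_sum_cycle:
  assumes "cycle G p"
  shows "walk_sum w p = (\<Sum>e\<in>walk_edges p. w e)"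
proof -
  obtain u v x y q where p: "p = u # v # x # y # q"
    using assms by (auto simp: cycle_def Suc_le_length_iff numeral_eq_Suc)
  have dist: "distinct (v # x # y # q)" and last: "last (y # q) = u"
    using assms by (auto simp: cycle_def p)
  \<comment> \<open>As the last vertex, \<open>u\<close> lies beyond \<open>x\<close> in a distinct
    list; this needs the length bound for cycles and excludes going back along the first
    edge.\<close>
  have "u \<in> set (y # q)" using last last_in_set by blast
  then have "u \<noteq> x" "u \<noteq> v" using dist by auto
  then have "{u, v} \<noteq> {v, x}" by (auto simp: doubleton_eq_iff)
  moreover have "{u, v} \<notin> walk_edges (x # y # q)"
    using walk_edges_subset[of "{u, v}" "x # y # q"] dist by fastforce
  ultimately have notin: "{u, v} \<notin> walk_edges (v # x # y # q)"
    by (subst walk_edges_Cons) blast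
  have "walk_sum w p = w {u, v} + (\<Sum>e\<in>walk_edges (v # x # y # q). w e)"
    using walk_sum_distinct[OF dist, of w] unfolding p walk_sum_Cons[of w u] by (rule arg_cong)
  also have "\<dots> = (\<Sum>e\<in>walk_edges p. w e)"
    unfolding p walk_edges_Cons[of u] using notin by (intro sum.insert[symmetric]) (rule finite_walk_edges)
  finally show ?thesis .
qed

text \<open>A repeated vertex in the tail splits the walk into two shorter closed walks. With a
  distinct tail the walk is a single vertex, a loop (impossible here), one edge there and back, or a
  cycle.\<close>

lemma closed_walk_sum:
  assumes "simple_graph G" and cycles: "\<And>q. cycle G q \<Longrightarrow> walk_sum w q = 0"
  shows "walk G p \<Longrightarrow> hd p = last p \<Longrightarrow> walk_sum w p = 0"
proof (induction p rule: length_induct)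
  case (1 p)
  then obtain u q where p: "p = u # q" by (cases p) (auto simp: walk_def)
  have edge2: "card e = 2" if "e \<in> edges G" for e
    using that assms(1) by (simp add: simple_graph_def)
  consider "q = []" | v where "q = [v]" | v where "q = [v, u]" "distinct q"
    | "cycle G p" | "\<not> distinct q"
  proof (cases "distinct q")
    case True
    show ?thesis
    proof (cases "length p \<ge> 4")
      case True
      then have "cycle G p" using 1(2,3) \<open>distinct q\<close> by (simp add: cycle_def p)
      then show ?thesis using that by blast
    next
      case False
      then have "length q < 3" by (simp add: p)
      then consider "q = []" | v where "q = [v]" | v z where "q = [v, z]"
        by (cases q; cases "tl q") auto
      then show ?thesis
        using that 1(3) True p \<open>distinct q\<close> by cases auto
    qed
  qed (use that in blast)
  then show ?case
  proof cases
    case 1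
    then show ?thesis by (simp add: p)
  next
    case (2 v)
    then have "{u} \<in> edges G" using "1.prems" by (simp add: p walk_Cons)
    from edge2[OF this] show ?thesis by simp
  next
    case (3 v)
    \<comment> \<open>The edge is traversed twice and cancels.\<close>
    then show ?thesis by (simp add: p insert_commute)
  next
    case 4
    then show ?thesis by (rule cycles)
  next
    case 5
    \<comment> \<open>The closed piece from \<open>y\<close> to \<open>y\<close> is cut out and the
      rest joined at \<open>y\<close>. Splitting the tail leaves \<open>u\<close> outside the closed
      piece, which is thus strictly shorter than \<open>p\<close>.\<close>
    then obtain xs y ys zs where q: "q = xs @ [y] @ ys @ [y] @ zs"
      using not_distinct_decomp by blast
    have p': "p = (u # xs) @ y # ys @ y # zs" by (simp add: p q)
    have w: "walk G ((u # xs) @ [y])" "walk G ((y # ys) @ [y])" "walk G (y # zs)"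
      using "1.prems"(1) walk_append[of G "u # xs" y "ys @ y # zs"] walk_append[of G "y # ys" y zs]
      by (simp_all add: p')
    have "walk_sum w ((y # ys) @ [y]) = 0"
      using 1(1) w(2) by (simp add: p')
    moreover have "walk_sum w ((u # xs) @ y # zs) = 0"
      using 1(1) w(1,3) "1.prems"(2) walk_append[of G "u # xs" y zs] by (simp add: p')
    moreover have "walk_sum w p = walk_sum w ((u # xs) @ [y]) + (walk_sum w ((y # ys) @ [y]) + walk_sum w (y # zs))"
      unfolding p' using walk_sum_append[of w "u # xs" y "ys @ y # zs"] walk_sum_append[of w "y # ys" y zs] by simp
    moreover have "walk_sum w ((u # xs) @ y # zs) = walk_sum w ((u # xs) @ [y]) + walk_sum w (y # zs)"
      by (rule walk_sum_append)
    ultimately show ?thesis by simp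
  qed
qed

text \<open>\<open>p\<close> followed by the reverse of \<open>q\<close> is closed, so the two sums
  add up to zero, which in characteristic two means that they are equal.\<close>

lemma walk_sum_unique:
  assumes "simple_graph G" and "\<And>q. cycle G q \<Longrightarrow> walk_sum w q = 0"
    and p: "walk G p" and q: "walk G q" and "hd p = hd q" and "last p = last q"
  shows "walk_sum w p = walk_sum w q"
proof -
  obtain p' v where p': "p = p' @ [v]" using p by (cases p rule: rev_cases) (auto simp: walk_def)
  obtain q' where q': "rev q = v # q'"
    using q assms(6) p' by (cases q rule: rev_cases) (auto simp: walk_def)
  have "last (v # q') = hd q" by (metis q' last_rev)
  moreover have "hd (p' @ v # q') = hd p" by (cases p') (simp_all add: p')
  ultimately have "hd (p' @ v # q') = last (p' @ v # q')" using assms(5) by simp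
  moreover have "walk G (p' @ v # q')"
    using p walk_rev[of G q] q unfolding walk_append[of G p' v q'] p' q' by simp
  ultimately have "walk_sum w (p' @ v # q') = 0" using closed_walk_sum[OF assms(1,2)] by blast
  then have "walk_sum w p + walk_sum w q = 0"
    using walk_sum_append[of w p' v q'] walk_sum_rev[of w q] by (simp add: p' q')
  then show ?thesis by (cases "walk_sum w p"; cases "walk_sum w q") auto
qed

section \<open>Distances under maps that send paths to lazy walks\<close>

text \<open>The path is built from the end of the walk: a new first vertex \<open>u\<close> is
  prepended unless it already occurs, in which case the path is cut back to start there.\<close>

lemma lazy_walk_imp_path:
  "lazy_walk H p \<Longrightarrow> \<exists>q. path_between H (hd p) (last p) q \<and> length q \<le> length p"
proof (induction p rule: induct_list012)
  case 1
  then show ?case by (simp add: lazy_walk_def)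
next
  case (2 u)
  then show ?case
    by (intro exI[of _ "[u]"]) (simp add: lazy_walk_def path_between_def path_def)
next
  case (3 u v p)
  then have "lazy_walk H (v # p)" by (simp add: lazy_walk_def)
  with 3 obtain q where q: "walk H q" "distinct q" "hd q = v" "last q = last (v # p)" "length q \<le> length (v # p)"
    by (auto simp: path_between_def path_def)
  show ?case
  proof (cases "u \<in> set q")
    case True
    then obtain a b where ab: "q = a @ u # b" by (meson split_list)
    then show ?thesis using q walk_append[of H a u b]
      by (intro exI[of _ "u # b"]) (auto simp: path_between_def path_def)
  next
    case False
    have "q \<noteq> []" using q by (auto simp: walk_def)
    then obtain q' where q': "q = v # q'" using q by (cases q) auto
    \<comment> \<open>\<open>q\<close> starts at \<open>v\<close> and avoids \<open>u\<close>, so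
      this step is not stationary.\<close>
    with False 3 have "{u, v} \<in> edges H" "u \<in> verts H" by (auto simp: lazy_walk_def)
    then show ?thesis using q False
      by (intro exI[of _ "u # q"]) (auto simp: path_between_def path_def q' walk_Cons)
  qed
qed

lemma graph_dist_le_of_lazy_walks:
  assumes "\<And>p. path G p \<Longrightarrow> lazy_walk H (map f p)"
  shows "graph_dist H (f u) (f v) \<le> graph_dist G u v"
  unfolding graph_dist_def
proof (rule INF_greatest)
  fix p assume "p \<in> {p. path_between G u v p}"
  then have p: "path G p" "hd p = u" "last p = v" "p \<noteq> []"
    by (auto simp: path_between_def path_def walk_def)
  from lazy_walk_imp_path[OF assms[OF p(1)]] p obtain q where
    "path_between H (f u) (f v) q" "length q \<le> length p"
    by (auto simp: hd_map last_map)
  then show "(INF q\<in>{q. path_between H (f u) (f v) q}. enat (length q - 1)) \<le> enat (length p - 1)"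
    by (intro INF_lower2[of q]) auto
qed

section \<open>Labels and the Cayley graph\<close>

context parity_graph
begin

section \<open>Vertex labels of an arbitrary consistent assignment\<close>

context
  fixes k :: nat and g :: "nat \<Rightarrow> bit vec" and r :: 'a
  assumes cons: "consistent G F t k g"
    and conn: "connected_graph G" and root: "r \<in> verts G"
begin

abbreviation edge_weight :: "nat \<Rightarrow> 'a set \<Rightarrow> bit" where
  "edge_weight i e \<equiv> g (edge_class F t e) $ i"

lemma g_carrier: "j < t \<Longrightarrow> g j \<in> carrier_vec k"
  using cons by (simp add: consistent_def)

lemma edge_vec_carrier: "e \<in> edges G \<Longrightarrow> g (edge_class F t e) \<in> carrier_vec k"
  using g_carrier edge_class_props(1) by blast

lemma class_sum_carrier:
  assumes "walk G p"
  shows "class_sum F t k g p \<in> carrier_vec k"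
  unfolding class_sum_def
  by (rule finsum_vec_closed) (use edge_vec_carrier walk_edges_subset_edges[OF assms] in auto)

lemma index_class_sum:
  assumes "walk G p" "i < k"
  shows "class_sum F t k g p $ i = (\<Sum>e\<in>walk_edges p. edge_weight i e)"
  unfolding class_sum_def
  by (rule index_finsum_vec) (use assms edge_vec_carrier walk_edges_subset_edges[OF assms(1)] in auto)

lemma walk_sum_cycle_eq_0:
  assumes "cycle G q" "i < k"
  shows "walk_sum (edge_weight i) q = 0"
  using cons assms index_class_sum[OF cycle_walk[OF assms(1)] assms(2)] walk_sum_cycle[OF assms(1)]
  by (simp add: consistent_def)

text \<open>Only \<open>p\<close> has to be a path: \<open>lab_edge\<close> takes for
  \<open>q\<close> a root path extended by one edge, which may repeat a vertex.\<close>

lemma index_class_sum_path: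
  assumes "path_between G u v p" "walk G q" "hd q = u" "last q = v" "i < k"
  shows "class_sum F t k g p $ i = walk_sum (edge_weight i) q"
proof -
  have p: "walk G p" "distinct p" "hd p = u" "last p = v"
    using assms(1) by (auto simp: path_between_def path_def)
  have "class_sum F t k g p $ i = walk_sum (edge_weight i) p"
    using index_class_sum[OF p(1) assms(5)] walk_sum_distinct[OF p(2)] by simp
  also have "\<dots> = walk_sum (edge_weight i) q"
    by (rule walk_sum_unique[OF simple]) (use assms p walk_sum_cycle_eq_0 in auto)
  finally show ?thesis .
qed

lemma conflict_free_consistent: "conflict_free G r F t k g"
  unfolding conflict_free_def
proof (intro ballI allI impI, elim conjE)
  fix v p q assume p: "path_between G r v p" and q: "path_between G r v q"
  then have w: "walk G p" "walk G q" "hd q = r" "last q = v"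
    by (auto simp: path_between_def path_def)
  show "class_sum F t k g p = class_sum F t k g q"
    using class_sum_carrier[OF w(1)] class_sum_carrier[OF w(2)]
      index_class_sum_path[OF p w(2-4)] index_class_sum_path[OF q w(2-4)]
    by (intro eq_vecI) auto
qed

abbreviation lab :: "'a \<Rightarrow> bit vec" where "lab \<equiv> labeling G r F t k g"

lemma root_path:
  assumes "v \<in> verts G"
  shows "path_between G r v (SOME p. path_between G r v p)"
  using conn root assms by (auto simp: connected_graph_def intro: someI_ex)

lemma lab_carrier:
  assumes "v \<in> verts G"
  shows "lab v \<in> carrier_vec k"
proof -
  have "walk G (SOME p. path_between G r v p)"
    using root_path[OF assms] unfolding path_between_def path_def by blast
  then show ?thesis unfolding labeling_def by (rule class_sum_carrier)
qed

text \<open>The chosen path to \<open>u\<close> extended by \<open>v\<close> is a walk from the root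
  to \<open>v\<close>, and its sum agrees with that of the path chosen for \<open>v\<close>.\<close>

lemma lab_edge:
  assumes e: "{u, v} \<in> edges G"
  shows "lab v = lab u + g (edge_class F t {u, v})"
proof -
  have uv: "u \<in> verts G" "v \<in> verts G" using e simple by (auto simp: simple_graph_def)
  define p where "p = (SOME p. path_between G r u p)"
  have p: "path_between G r u p" unfolding p_def by (rule root_path) fact
  then have "p \<noteq> []" "last p = u" by (auto simp: path_between_def path_def walk_def)
  then obtain p' where p': "p = p' @ [u]" by (metis append_butlast_last_id)
  have walks: "walk G p" "walk G (p @ [v])" "hd (p @ [v]) = r" "hd p = r"
    using p e uv by (auto simp: path_between_def path_def p' walk_append[of G p' u "[v]"] walk_Cons hd_append)
  have "lab v $ i = lab u $ i + g (edge_class F t {u, v}) $ i" if i: "i < k" for i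
  proof -
    have "lab v $ i = walk_sum (edge_weight i) (p @ [v])"
      unfolding labeling_def by (rule index_class_sum_path[OF root_path[OF uv(2)]]) (use walks i in auto)
    also have "\<dots> = walk_sum (edge_weight i) p + edge_weight i {u, v}"
      using walk_sum_append[of "edge_weight i" p' u "[v]"] by (simp add: p')
    also have "walk_sum (edge_weight i) p = lab u $ i"
      unfolding labeling_def p_def[symmetric]
      by (rule index_class_sum_path[OF p, symmetric]) (use walks i \<open>last p = u\<close> in auto)
    finally show ?thesis .
  qed
  then show ?thesis
    using lab_carrier[OF uv(1)] lab_carrier[OF uv(2)] edge_vec_carrier[OF e] by (intro eq_vecI) auto
qed

text \<open>Cancellation in \<open>lab_edge\<close>; it locates the stationary steps of the image
  walk.\<close>

lemma lab_edge_eq_iff: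
  assumes e: "{u, v} \<in> edges G"
  shows "lab u = lab v \<longleftrightarrow> g (edge_class F t {u, v}) = 0\<^sub>v k"
proof -
  have u: "u \<in> verts G" using e simple by (auto simp: simple_graph_def)
  let ?x = "g (edge_class F t {u, v})"
  have car: "lab u \<in> carrier_vec k" "?x \<in> carrier_vec k"
    using lab_carrier[OF u] edge_vec_carrier[OF e] by auto
  interpret K: comm_group "Z2 k" by (rule comm_group_Z2)
  have "lab u + ?x = lab u \<longleftrightarrow> ?x = 0\<^sub>v k"
    using K.l_cancel_one[of "lab u" ?x] car by (simp add: monoid_vec_simps)
  then show ?thesis using lab_edge[OF e] by metis
qed

section \<open>Images of paths in the Cayley graph\<close>

abbreviation S :: "bit vec set" where "S \<equiv> {g j |j. j < t \<and> g j \<noteq> 0\<^sub>v k}"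

abbreviation Cay :: "bit vec ugraph" where "Cay \<equiv> cayley_graph (Z2 k) S"

lemma lab_edge_Cay:
  assumes e: "{u, v} \<in> edges G" and nz: "g (edge_class F t {u, v}) \<noteq> 0\<^sub>v k"
  shows "{lab u, lab v} \<in> edges Cay"
proof -
  have u: "u \<in> verts G" using e simple by (auto simp: simple_graph_def)
  have "g (edge_class F t {u, v}) \<in> S" using nz edge_class_props(1)[OF e] by blast
  then show ?thesis
    using lab_carrier[OF u] lab_edge[OF e] by (auto simp: cayley_graph_def monoid_vec_simps)
qed

lemma path_lazy_walk_Cay:
  assumes "path G p"
  shows "lazy_walk Cay (map lab p)"
proof -
  have w: "p \<noteq> []" "set p \<subseteq> verts G" "successively (\<lambda>u v. {u, v} \<in> edges G) p"
    using assms by (auto simp: path_def walk_def)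
  have "successively (\<lambda>u v. lab u = lab v \<or> {lab u, lab v} \<in> edges Cay) p"
    by (rule successively_mono[OF w(3)]) (use lab_edge_Cay lab_edge_eq_iff in blast)
  then show ?thesis using w lab_carrier
    by (auto simp: lazy_walk_def successively_map cayley_graph_def monoid_vec_simps)
qed

text \<open>Monotonicity with the extra knowledge that each pair is an edge of \<open>p\<close>,
  since \<open>path_walk_Cay\<close> assumes nonzero elements only on those edges.\<close>

lemma successively_walk_edges:
  "successively Q p \<Longrightarrow> (\<And>u v. Q u v \<Longrightarrow> {u, v} \<in> walk_edges p \<Longrightarrow> Q' u v) \<Longrightarrow> successively Q' p"
  by (induction p rule: induct_list012) auto

lemma path_walk_Cay:
  assumes "path G p" and nz: "\<forall>e\<in>walk_edges p. g (edge_class F t e) \<noteq> 0\<^sub>v k"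
  shows "walk Cay (map lab p)"
proof -
  have w: "p \<noteq> []" "set p \<subseteq> verts G" "successively (\<lambda>u v. {u, v} \<in> edges G) p"
    using assms by (auto simp: path_def walk_def)
  have "successively (\<lambda>u v. {lab u, lab v} \<in> edges Cay) p"
    by (rule successively_walk_edges[OF w(3)]) (use lab_edge_Cay nz in blast)
  then show ?thesis using w lab_carrier
    by (auto simp: walk_def successively_map cayley_graph_def monoid_vec_simps)
qed

text \<open>Every element is its own inverse. By \<open>surj\<close> every vector is a sum of
  multiples of the \<open>g j\<close>, each of them zero or in \<open>S\<close>, so \<open>S\<close>
  generates.\<close>

lemma connection_set_nonzero_classes:
  assumes surj: "(\<lambda>x. assign_mat k t g *\<^sub>v x) ` carrier_vec t = carrier_vec k"
  shows "connection_set (Z2 k) S"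
proof -
  interpret K: comm_group "Z2 k" by (rule comm_group_Z2)
  have sub: "S \<subseteq> carrier (Z2 k)" using g_carrier by (auto simp: monoid_vec_simps)
  have "inv\<^bsub>Z2 k\<^esub> s = s" if "s \<in> S" for s
    using that sub by (intro K.inv_equality) (auto simp: monoid_vec_simps add_self_bit_vec)
  then have "m_inv (Z2 k) ` S = (\<lambda>s. s) ` S" by (rule image_cong[OF refl])
  then have inv: "m_inv (Z2 k) ` S = S" by (simp only: image_ident)
  have gen: "subgroup (generate (Z2 k) S) (Z2 k)" by (rule K.generate_is_subgroup[OF sub])
  have 0: "0\<^sub>v k \<in> generate (Z2 k) S" using subgroup.one_closed[OF gen] by (simp add: monoid_vec_simps)
  have gj: "b \<cdot>\<^sub>v g j \<in> generate (Z2 k) S" if j: "j < t" for j b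
  proof (cases "b = 0 \<or> g j = 0\<^sub>v k")
    case True
    then have "b \<cdot>\<^sub>v g j = 0\<^sub>v k" using g_carrier[OF j] by auto
    then show ?thesis using 0 by simp
  next
    case False
    then have "b = 1" "g j \<in> S" using j by auto
    then show ?thesis by (simp add: generate.incl)
  qed
  have fin: "finsum_vec TYPE(bit) k (\<lambda>j. x $ j \<cdot>\<^sub>v g j) J \<in> generate (Z2 k) S"
    if "finite J" "J \<subseteq> {..<t}" for x J
    using that
  proof (induction J)
    case empty
    show ?case using 0 by (simp add: finsum_vec_empty)
  next
    case (insert j J)
    then have "finsum_vec TYPE(bit) k (\<lambda>j. x $ j \<cdot>\<^sub>v g j) (insert j J)
        = x $ j \<cdot>\<^sub>v g j + finsum_vec TYPE(bit) k (\<lambda>j. x $ j \<cdot>\<^sub>v g j) J"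
      using g_carrier by (intro finsum_vec_insert) auto
    moreover have "\<dots> \<in> generate (Z2 k) S"
      using subgroup.m_closed[OF gen gj[of j "x $ j"] insert.IH] insert.prems by (simp add: monoid_vec_simps)
    ultimately show ?case by simp
  qed
  have "carrier_vec k \<subseteq> generate (Z2 k) S"
  proof
    fix y :: "bit vec" assume "y \<in> carrier_vec k"
    then obtain x where "x \<in> carrier_vec t" "y = assign_mat k t g *\<^sub>v x" using surj by (metis imageE)
    then show "y \<in> generate (Z2 k) S" using fin[of "{..<t}" x] g_carrier by (simp add: assign_mat_eq_finsum)
  qed
  then have "generate (Z2 k) S = carrier (Z2 k)"
    using subgroup.subset[OF gen] by (auto simp: monoid_vec_simps)
  then show ?thesis using sub inv unfolding connection_set_def by (auto simp: monoid_vec_simps)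
qed

end

end

section \<open>The three claims for every isomorphism from the quotient to
  \<open>Z2 k\<close>\<close>

theorem theorem4:
  fixes G :: "'v ugraph" and r :: 'v
    and F :: "nat \<Rightarrow> 'v set set" and t :: nat
    and B :: "nat \<Rightarrow> 'v list"
    and A :: "bit mat" and \<rho> k :: nat and R :: "bit vec set"
  assumes "simple_graph G" and "finite (verts G)" and "connected_graph G"
    and "r \<in> verts G"
    and "inj_on F {..<t}" and "partition_on (edges G) (F ` {..<t})"
    and "cycle_basis G B"
    and "A = parity_matrix G F t B"
    and "\<rho> = vec_space.rank (cycle_rank G) A"
    and "k = t - \<rho>"
    and "R = vec_space.row_space t A"
  shows "\<rho> \<le> t \<and> (Z2 t Mod R) \<cong> Z2 k \<and>
    (\<forall>k' g'. most_generic G F t k' g' \<longrightarrow> assignment_dim t k' g' = k) \<and>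
    (\<forall>\<phi> \<in> iso (Z2 t Mod R) (Z2 k).
      let g = (\<lambda>j. \<phi> (R #>\<^bsub>Z2 t\<^esub> unit_vec t j));
          lab = labeling G r F t k g;
          S = {g j |j. j < t \<and> g j \<noteq> 0\<^sub>v k};
          Cay = cayley_graph (Z2 k) S
      in
        \<comment> \<open>(i)\<close>
        (most_generic G F t k g \<and> assignment_dim t k g = k) \<and>
        \<comment> \<open>(ii)\<close>
        conflict_free G r F t k g \<and>
        \<comment> \<open>(iii)\<close>
        connection_set (Z2 k) S \<and>
        (\<forall>p. path G p \<longrightarrow> lazy_walk Cay (map lab p)) \<and>
        (\<forall>u v. {u, v} \<in> edges G \<longrightarrow>
           (lab u = lab v \<longleftrightarrow> g (edge_class F t {u, v}) = 0\<^sub>v k)) \<and>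
        (\<forall>p. path G p \<and> (\<forall>e\<in>walk_edges p. g (edge_class F t e) \<noteq> 0\<^sub>v k) \<longrightarrow>
           walk Cay (map lab p)) \<and>
        (\<forall>u\<in>verts G. \<forall>v\<in>verts G.
           graph_dist Cay (lab u) (lab v) \<le> graph_dist G u v \<and>
           \<not> graph_dist Cay (lab u) (lab v) > graph_dist G u v \<and>
           (graph_dist Cay (lab u) (lab v) \<noteq> graph_dist G u v \<longrightarrow>
              graph_dist Cay (lab u) (lab v) < graph_dist G u v)))"
proof -
  interpret parity_graph G F t B
    by unfold_locales fact+
  have R: "R = parity_graph.R G F t B" using assms(8,11) by (simp add: R_def)
  have card_R: "card R = 2 ^ \<rho>"
    unfolding assms(8,9,11) by (rule row_space_bit(2)[OF A_carrier])
  have Rsub: "subgroup R (Z2 t)" unfolding R by (rule R_subgroup)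
  have \<rho>: "\<rho> \<le> t" and iso: "(Z2 t Mod R) \<cong> Z2 k"
    using quotient_iso_Z2[OF Rsub card_R] assms(10) by auto
  have quot: "most_generic G F t k (\<lambda>j. \<phi> (R #>\<^bsub>Z2 t\<^esub> unit_vec t j)) \<and>
      assignment_dim t k (\<lambda>j. \<phi> (R #>\<^bsub>Z2 t\<^esub> unit_vec t j)) = k"
    if "\<phi> \<in> iso (Z2 t Mod R) (Z2 k)" for \<phi>
    using most_generic_quotient[of "\<lambda>x. \<phi> (R #>\<^bsub>Z2 t\<^esub> x)" k] iso_quotient_hom[OF Rsub that]
    by (simp add: R)
  \<comment> \<open>One quotient assignment fixes the dimension shared by all most generic
    assignments.\<close>
  obtain \<phi>0 where \<phi>0: "\<phi>0 \<in> iso (Z2 t Mod R) (Z2 k)" using iso by (auto simp: is_iso_def)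
  have dims: "\<forall>k' g'. most_generic G F t k' g' \<longrightarrow> assignment_dim t k' g' = k"
    using quot[OF \<phi>0] most_generic_dim_unique by metis
  show ?thesis
  proof (intro conjI ballI \<rho> iso dims, goal_cases)
    case (1 \<phi>)
    define h where "h = (\<lambda>x. \<phi> (R #>\<^bsub>Z2 t\<^esub> x))"
    define g where "g = (\<lambda>j. h (unit_vec t j))"
    have generic: "most_generic G F t k g" and dim: "assignment_dim t k g = k"
      using quot[OF 1] by (auto simp: g_def h_def)
    have cons: "consistent G F t k g" using generic by (simp add: most_generic_def)
    note ctxt = cons assms(3,4)
    have h: "h \<in> hom (Z2 t) (Z2 k)" "h ` carrier_vec t = carrier_vec k"
      unfolding h_def by (rule iso_quotient_hom[OF Rsub 1])+
    \<comment> \<open>The matrix of \<open>g\<close> acts as \<open>h\<close>, so its surjectivity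
      supplies the premise of \<open>connection_set_nonzero_classes\<close>.\<close>
    have "(\<lambda>x. assign_mat k t g *\<^sub>v x) ` carrier_vec t = h ` carrier_vec t"
      unfolding g_def by (intro image_cong refl hom_eq_assign_mat[OF h(1), symmetric])
    note conn_set = connection_set_nonzero_classes[OF ctxt this[unfolded h(2)]]
    note le = graph_dist_le_of_lazy_walks[OF path_lazy_walk_Cay[OF ctxt]]
    have g_eq: "(\<lambda>j. \<phi> (R #>\<^bsub>Z2 t\<^esub> unit_vec t j)) = g" by (simp add: g_def h_def)
    show ?case
      unfolding g_eq unfolding Let_def
    proof (intro conjI generic dim conflict_free_consistent[OF ctxt] conn_set allI impI ballI, goal_cases)
      case (1 p)
      then show ?case by (rule path_lazy_walk_Cay[OF ctxt])
    next
      case (2 u v)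
      then show ?case by (rule lab_edge_eq_iff[OF ctxt])
    next
      case (3 p)
      then show ?case using path_walk_Cay[OF ctxt] by blast
    next
      case (4 u v)
      show ?case by (rule le)
    next
      case (5 u v)
      then show ?case using le by (simp add: not_less)
    next
      case (6 u v)
      then show ?case using le by (simp add: order.strict_iff_order)
    qed
  qed
qed

end
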